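(* Let $\mathcal{S}$ be a finite or countable set, let $p=(p_{jk})_{j,k\in\mathcal{S}}$ be an irreducible and recurrent transition matrix with stationary measure $(m_j)_{j\in\mathcal{S}}$, and let $X=(X_n)_{n\in\mathbb{Z}}$ be the two-sided Markov chain with transition matrix $p$ and initial state $X_0=i$, where $i\in\mathcal{S}$. Let $\nu=(\nu_j)_{j\in\mathcal{S}}$ be any probability measure on $\mathcal{S}$. Then the following statements are equivalent. (a) There exists a non-randomized random time $T$ such that $(X_{n+T})_{n\in\mathbb{Z}}$ is a two-sided Markov chain with transition matrix $p$ and $X_T$ has law $\nu$. (b) The stationary measure satisfies $\frac{m_i}{m_j}\,\nu_j\in\mathbb{Z}$ for all $j\in\mathcal{S}$. Moreover, if a random time $T$ as in (a) exists, then it can always be taken to be a stopping time.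
   Context: An irreducible and recurrent transition matrix $p$ on a finite or countable set $\mathcal{S}$ has a stationary measure $(m_j)_{j\in\mathcal{S}}$ with strictly positive weights, unique up to a positive multiple (finite or infinite total mass). The dual transition matrix is $p^*_{jk}=(m_k/m_j)\,p_{kj}$. The two-sided Markov chain with transition matrix $p$ and initial distribution $\nu$ is the process $(X_n)_{n\in\mathbb{Z}}$ such that $X_0$ has law $\nu$ and, given $X_0$, the processes $(X_n)_{n\ge0}$ and $(X_{-n})_{n\ge0}$ are independent Markov chains started in $X_0$ with transition matrices $p$ and $p^*$, respectively. Its law on $\mathcal{S}^{\mathbb{Z}}$ is denoted $\mathbb{P}_\nu$, and $\mathbb{P}_i=\mathbb{P}_{\delta_i}$ is the law with initial state $X_0=i$. Thus (a) says that under $\mathbb{P}_i$ the process $(X_{n+T})_{n\in\mathbb{Z}}$ has law $\mathbb{P}_\nu$. A random time is a $\mathbb{Z}$-valued (almost surely finite) random variable; it is non-randomized if it is a measurable function of the trajectory $X$. A stopping time is a non-negative random time $T$ with $\{T=n\}\in\sigma(X_k\colon k\le n)$ for all $n\ge 0$. *)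

theory Defs
  imports "HOL-Probability.Probability"
begin

text \<open>
  The state space is a type of class \<open>countable\<close> (finite or countably infinite), always with the
  discrete sigma-algebra.  Matrices on it are real-valued functions of two arguments.
\<close>

definition transition_matrix :: "('s::countable \<Rightarrow> 's \<Rightarrow> real) \<Rightarrow> bool" where
  "transition_matrix p \<longleftrightarrow> (\<forall>j k. 0 \<le> p j k) \<and> (\<forall>j. (p j has_sum 1) UNIV)"

fun matrix_power :: "('s::countable \<Rightarrow> 's \<Rightarrow> real) \<Rightarrow> nat \<Rightarrow> 's \<Rightarrow> 's \<Rightarrow> real" where
  "matrix_power p 0 j k = of_bool (j = k)"
| "matrix_power p (Suc n) j k = infsum (\<lambda>l. p j l * matrix_power p n l k) UNIV"

definition irreducible_matrix :: "('s::countable \<Rightarrow> 's \<Rightarrow> real) \<Rightarrow> bool" where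
  "irreducible_matrix p \<longleftrightarrow> (\<forall>j k. \<exists>n. 0 < matrix_power p n j k)"

definition markov_chain ::
  "'w measure \<Rightarrow> (nat \<Rightarrow> 'w \<Rightarrow> 's::countable) \<Rightarrow> ('s \<Rightarrow> 's \<Rightarrow> real) \<Rightarrow> bool" where
  "markov_chain M Y q \<longleftrightarrow>
     prob_space M \<and>
     (\<forall>n. Y n \<in> measurable M (count_space UNIV)) \<and>
     (\<forall>n (x :: nat \<Rightarrow> 's) y.
        \<P>(\<omega> in M. \<forall>k\<le>n. Y k \<omega> = x k) > 0 \<longrightarrow>
        cond_prob M (\<lambda>\<omega>. Y (Suc n) \<omega> = y) (\<lambda>\<omega>. \<forall>k\<le>n. Y k \<omega> = x k) = q (x n) y)"

text \<open>
  The chain started in \<open>j\<close> returns to \<open>j\<close> almost surely.  It is realised by the coordinate process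
  on the path space; as its law exists and is determined by \<open>p\<close> and \<open>j\<close>, it makes no
  difference whether \<open>N\<close> is quantified existentially or universally.
\<close>
definition recurrent_matrix :: "('s::countable \<Rightarrow> 's \<Rightarrow> real) \<Rightarrow> bool" where
  "recurrent_matrix p \<longleftrightarrow>
     (\<forall>j. \<exists>N :: (nat \<Rightarrow> 's) measure.
        markov_chain N (\<lambda>n x. x n) p \<and> (AE x in N. x 0 = j) \<and> (AE x in N. \<exists>n>0. x n = j))"

definition stationary_measure :: "('s::countable \<Rightarrow> 's \<Rightarrow> real) \<Rightarrow> ('s \<Rightarrow> real) \<Rightarrow> bool" where
  "stationary_measure p m \<longleftrightarrow>
     (\<forall>j. 0 < m j) \<and> (\<forall>k. ((\<lambda>j. m j * p j k) has_sum m k) UNIV)"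

definition dual_matrix :: "('s::countable \<Rightarrow> real) \<Rightarrow> ('s \<Rightarrow> 's \<Rightarrow> real) \<Rightarrow> 's \<Rightarrow> 's \<Rightarrow> real" where
  "dual_matrix m p j k = m k / m j * p k j"

text \<open>
  Conditioning on \<open>X 0 = j\<close>, an event of positive probability for \<open>j \<in> set_pmf \<nu>\<close>, is expressed
  by \<^const>\<open>uniform_measure\<close>, whose value at \<open>B\<close> is the probability of \<open>B\<close> given that event.
\<close>
definition two_sided_markov_chain ::
  "'w measure \<Rightarrow> (int \<Rightarrow> 'w \<Rightarrow> 's::countable) \<Rightarrow> ('s \<Rightarrow> 's \<Rightarrow> real) \<Rightarrow> ('s \<Rightarrow> real) \<Rightarrow> 's pmf \<Rightarrow> bool"
where
  "two_sided_markov_chain M X p m \<nu> \<longleftrightarrow>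
     prob_space M \<and>
     (\<forall>n. X n \<in> measurable M (count_space UNIV)) \<and>
     distr M (count_space UNIV) (X 0) = measure_pmf \<nu> \<and>
     (\<forall>j\<in>set_pmf \<nu>.
        let Mj = uniform_measure M {\<omega> \<in> space M. X 0 \<omega> = j} in
          markov_chain Mj (\<lambda>n. X (int n)) p \<and>
          markov_chain Mj (\<lambda>n. X (- int n)) (dual_matrix m p) \<and>
          prob_space.indep_var Mj
            (Pi\<^sub>M (UNIV :: nat set) (\<lambda>_. count_space UNIV)) (\<lambda>\<omega> n. X (int n) \<omega>)
            (Pi\<^sub>M (UNIV :: nat set) (\<lambda>_. count_space UNIV)) (\<lambda>\<omega> n. X (- int n) \<omega>))"

text \<open>
  The value \<open>None\<close> stands for an infinite time.  It has probability zero but must not be excluded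
  altogether: a hitting time, for instance, is in general only almost surely finite, and redefining
  it on a null set would destroy the stopping time property.
\<close>
definition random_time :: "'w measure \<Rightarrow> ('w \<Rightarrow> int option) \<Rightarrow> bool" where
  "random_time M T \<longleftrightarrow> T \<in> measurable M (count_space UNIV) \<and> (AE \<omega> in M. T \<omega> \<noteq> None)"

definition nonrandomized_time ::
  "'w measure \<Rightarrow> (int \<Rightarrow> 'w \<Rightarrow> 's::countable) \<Rightarrow> ('w \<Rightarrow> int option) \<Rightarrow> bool" where
  "nonrandomized_time M X T \<longleftrightarrow>
     random_time M T \<and>
     (\<exists>\<tau> \<in> measurable (Pi\<^sub>M (UNIV :: int set) (\<lambda>_. count_space UNIV)) (count_space UNIV).
        \<forall>\<omega>\<in>space M. T \<omega> = \<tau> (\<lambda>n. X n \<omega>))"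

definition two_sided_stopping_time ::
  "'w measure \<Rightarrow> (int \<Rightarrow> 'w \<Rightarrow> 's::countable) \<Rightarrow> ('w \<Rightarrow> int option) \<Rightarrow> bool" where
  "two_sided_stopping_time M X T \<longleftrightarrow>
     random_time M T \<and>
     (\<forall>\<omega>\<in>space M. \<forall>t. T \<omega> = Some t \<longrightarrow> 0 \<le> t) \<and>
     (\<forall>n::nat. {\<omega> \<in> space M. T \<omega> = Some (int n)} \<in>
        sigma_sets (space M) {X k -` A \<inter> space M | k A. k \<le> int n})"

text \<open>On the null set where \<open>T\<close> is infinite the shifted process has an irrelevant value.\<close>
definition shifted_process ::
  "(int \<Rightarrow> 'w \<Rightarrow> 's) \<Rightarrow> ('w \<Rightarrow> int option) \<Rightarrow> int \<Rightarrow> 'w \<Rightarrow> 's" where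
  "shifted_process X T n \<omega> = X (n + the (T \<omega>)) \<omega>"

end

theory Submission
  imports Defs
begin

text \<open>
  Write \<open>P j\<close> for the law of the two-sided chain started in \<open>j\<close>. As \<open>m\<close> is stationary, the measure with
  weight \<open>m j\<close> on \<open>P j\<close> is shift invariant. Let every visit to \<open>i\<close> send unit mass to the time that \<open>T\<close> selects
  from there. Invariance (mass transport) shows that, restricted to \<open>X 0 = j\<close>, the law of the path seen from \<open>T\<close>
  has density \<open>m j / m i\<close> times the mass arriving at time 0 with respect to \<open>P j\<close>. If this law is
  \<open>\<nu> j\<close> times \<open>P j\<close>, the arriving mass is almost surely constant and equal to \<open>c j = m i / m j * \<nu> j\<close>; as it counts
  visits to \<open>i\<close>, the number \<open>c j\<close> is an integer.

  Conversely, if all \<open>c j\<close> are integers, let \<open>T\<close> be the first \<open>n \<ge> 0\<close> at which the visits to \<open>i\<close> in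
  \<open>{0..n}\<close>, each counted 1, are balanced by the visits to all \<open>j\<close>, each counted \<open>c j\<close>. Visits to \<open>j\<close>
  then receive at most \<open>c j\<close> units, so the law of the path seen from \<open>T\<close> is dominated by that of the chain
  started from \<open>\<nu>\<close>, and the two agree as soon as \<open>T\<close> is almost surely finite. Finiteness holds because the
  walk recording the imbalance has mean zero over an excursion from \<open>i\<close> and only makes upward jumps of size 1:
  summing the harmonic equation for its survival probability over all levels up to \<open>L\<close> forces that probability to vanish.
\<close>

subsection \<open>Path spaces and one-sided chains\<close>

text \<open>The total mass of \<open>m\<close> may be infinite, so invariance is used on events that
  fix the states at two times, where the weighted measures are finite. Identities in
  \<open>ennreal\<close> are arranged without subtraction, and each cancellation is secured by a
  finiteness bound.

  The balancing time looks only at times from 0 on, while the path seen from it must have the right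
  past as well. Mass transport accepts events of the whole two-sided path, so past and future are
  treated together.

  The mean of the walk over an excursion is zero because the expected number of visits to
  \<open>j\<close> is \<open>m j / m i\<close>: the mean is 1 minus the sum of
  \<open>c j * m j / m i\<close>, that is, 1 minus the total mass of \<nu>. Let \<open>v\<close> be
  the survival probability from level 1 at \<open>i\<close>, and \<open>V\<close> its limit at high
  levels. \<open>V\<close> is bounded and harmonic, hence the same for all states. When levels up to
  \<open>L\<close> are summed, an upward jump of size 1 lets a single new level \<open>L + 1\<close>
  enter, worth at most \<open>V\<close>, while the levels lost at the top are worth \<open>V\<close>
  times the sum of \<open>c j * m j / m i\<close> in the limit. So \<open>v + V \<le> V\<close>.
  This works with the one-step Markov property alone, without splitting the path into independent
  excursions.\<close>

abbreviation paths :: "('t \<Rightarrow> 's) measure" where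
  "paths \<equiv> Pi\<^sub>M UNIV (\<lambda>_. count_space UNIV)"

lemma space_paths [simp]: "space paths = UNIV"
  by (simp add: space_PiM)

lemma measurable_paths:
  "(\<And>t. X t \<in> measurable M (count_space UNIV)) \<Longrightarrow> (\<lambda>\<omega> t. X t \<omega>) \<in> measurable M paths"
  by (rule measurable_PiM_single') (auto simp: space_PiM)

lemma measurable_coordinate_const [measurable]: "(\<lambda>x. x t) \<in> measurable paths (count_space UNIV)"
  by simp

text \<open>Since states are countable, every finite-dimensional product set is a countable disjoint
  union of cylinders that prescribe exact values. The window \<open>W\<close> may be larger than
  \<open>J\<close>, so that only contiguous windows have to be computed, where cylinder
  probabilities are products of transition probabilities.\<close>

lemma paths_measure_eqI:
  fixes A B :: "('t \<Rightarrow> 's::countable) measure"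
  assumes [simp]: "sets A = sets paths" "sets B = sets paths" and "finite_measure A"
    and cyl: "\<And>J. finite J \<Longrightarrow> \<exists>W. finite W \<and> J \<subseteq> W \<and>
      (\<forall>y. emeasure A {x. \<forall>t\<in>W. x t = y t} = emeasure B {x. \<forall>t\<in>W. x t = y t})"
  shows "A = B"
proof (rule measure_eqI_PiM_infinite)
  show "finite_measure A" by fact
  fix C and J :: "'t set" assume J: "finite J"
  from cyl[OF J] obtain W where W: "finite W" "J \<subseteq> W"
    and eq: "\<And>y. emeasure A {x. \<forall>t\<in>W. x t = y t} = emeasure B {x. \<forall>t\<in>W. x t = y t}" by blast
  define E where "E = (PiE W (\<lambda>t. if t \<in> J then C t else UNIV) :: ('t \<Rightarrow> 's) set)"
  define cy where "cy y = {x. \<forall>t\<in>W. x t = y t}" for y :: "'t \<Rightarrow> 's"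
  have "countable E" unfolding E_def by (rule countable_PiE) (use W in auto)
  have cy: "cy y \<in> sets paths" for y
  proof -
    have "Measurable.pred paths (\<lambda>x. \<forall>t\<in>W. x t = y t)" using W by measurable
    then show ?thesis unfolding cy_def pred_def by simp
  qed
  have dis: "disjoint_family_on cy E"
    unfolding disjoint_family_on_def cy_def E_def
  proof (intro ballI impI)
    fix y z assume yz: "y \<in> PiE W (\<lambda>t. if t \<in> J then C t else UNIV)"
      "z \<in> PiE W (\<lambda>t. if t \<in> J then C t else UNIV)" "y \<noteq> z"
    have "\<exists>t\<in>W. y t \<noteq> z t" using PiE_ext[OF yz(1,2)] yz(3) by blast
    then show "{x. \<forall>t\<in>W. x t = y t} \<inter> {x. \<forall>t\<in>W. x t = z t} = {}" by force
  qed
  have un: "prod_emb UNIV (\<lambda>_. count_space UNIV) J (PiE J C) = (\<Union>y\<in>E. cy y)"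
  proof (intro set_eqI iffI)
    fix x assume x: "x \<in> prod_emb UNIV (\<lambda>_. count_space UNIV) J (PiE J C)"
    then have "restrict x W \<in> E" using W by (auto simp: prod_emb_def E_def PiE_iff restrict_PiE_iff)
    moreover have "x \<in> cy (restrict x W)" by (auto simp: cy_def)
    ultimately show "x \<in> (\<Union>y\<in>E. cy y)" by blast
  next
    fix x assume "x \<in> (\<Union>y\<in>E. cy y)"
    then obtain y where "y \<in> E" "x \<in> cy y" by blast
    then have "x t \<in> C t" if "t \<in> J" for t
      using that W unfolding E_def cy_def PiE_iff by (metis (mono_tags, lifting) mem_Collect_eq subsetD)
    then show "x \<in> prod_emb UNIV (\<lambda>_. count_space UNIV) J (PiE J C)"
      by (auto simp: prod_emb_def restrict_PiE_iff)
  qed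
  have "emeasure A (\<Union>y\<in>E. cy y) = (\<integral>\<^sup>+y. emeasure A (cy y) \<partial>count_space E)"
    by (rule emeasure_UN_countable) (use cy dis \<open>countable E\<close> in auto)
  also have "\<dots> = (\<integral>\<^sup>+y. emeasure B (cy y) \<partial>count_space E)" using eq by (simp add: cy_def)
  also have "\<dots> = emeasure B (\<Union>y\<in>E. cy y)"
    by (rule emeasure_UN_countable[symmetric]) (use cy dis \<open>countable E\<close> in auto)
  finally show "emeasure A (prod_emb UNIV (\<lambda>_. count_space UNIV) J (PiE J C)) =
    emeasure B (prod_emb UNIV (\<lambda>_. count_space UNIV) J (PiE J C))" unfolding un .
qed simp_all

lemma nn_integral_count_space_has_sum:
  fixes f :: "'a \<Rightarrow> real"
  assumes nonneg: "\<And>k. 0 \<le> f k" and sum: "(f has_sum s) UNIV"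
  shows "(\<integral>\<^sup>+k. ennreal (f k) \<partial>count_space UNIV) = ennreal s"
proof -
  have "(\<lambda>k. norm (f k)) summable_on UNIV"
    using sum nonneg by (auto simp: summable_on_def)
  then have abs: "Infinite_Set_Sum.abs_summable_on f UNIV"
    unfolding abs_summable_equivalent .
  then have "(\<integral>\<^sup>+k. ennreal (f k) \<partial>count_space UNIV) = ennreal (infsetsum f UNIV)"
    using nonneg by (intro nn_integral_conv_infsetsum) auto
  also have "infsetsum f UNIV = s"
    using infsetsum_infsum[OF abs] infsumI[OF sum] by simp
  finally show ?thesis .
qed

section \<open>Construction and uniqueness of the law of the one-sided chain\<close>

definition row_pmf :: "('s::countable \<Rightarrow> 's \<Rightarrow> real) \<Rightarrow> 's \<Rightarrow> 's pmf" where
  "row_pmf q j = embed_pmf (q j)"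

lemma pmf_row_pmf:
  assumes "transition_matrix q"
  shows "pmf (row_pmf q j) k = q j k"
proof -
  have nonneg: "\<And>k. 0 \<le> q j k" and sum: "(q j has_sum 1) UNIV"
    using assms by (auto simp: transition_matrix_def)
  show ?thesis
    unfolding row_pmf_def
    by (subst pmf_embed_pmf) (use nonneg nn_integral_count_space_has_sum[OF nonneg sum] in auto)
qed

text \<open>
  The chain is driven by independent maps: the coordinate at \<open>(n, s)\<close>, with law \<open>row_pmf q s\<close>, is the
  state at time \<open>n + 1\<close> if the chain is in \<open>s\<close> at time \<open>n\<close>. Along a fixed trajectory the coordinates used are
  pairwise different, so cylinder probabilities are products.
\<close>
fun driven_chain :: "'s \<Rightarrow> (nat \<times> 's \<Rightarrow> 's) \<Rightarrow> nat \<Rightarrow> 's" where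
  "driven_chain j \<omega> 0 = j"
| "driven_chain j \<omega> (Suc n) = \<omega> (n, driven_chain j \<omega> n)"

definition chain_law :: "('s::countable \<Rightarrow> 's \<Rightarrow> real) \<Rightarrow> 's \<Rightarrow> (nat \<Rightarrow> 's) measure" where
  "chain_law q j = distr (Pi\<^sub>M UNIV (\<lambda>i. measure_pmf (row_pmf q (snd i)))) paths (driven_chain j)"

lemma measurable_driven_chain [measurable]:
  fixes q :: "'s::countable \<Rightarrow> 's \<Rightarrow> real"
  shows "driven_chain j \<in> measurable (Pi\<^sub>M UNIV (\<lambda>i::nat \<times> _. measure_pmf (row_pmf q (snd i)))) paths"
proof -
  let ?M = "Pi\<^sub>M UNIV (\<lambda>i::nat \<times> _. measure_pmf (row_pmf q (snd i)))"
  have "(\<lambda>\<omega>. driven_chain j \<omega> n) \<in> measurable ?M (count_space UNIV)" for n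
  proof (induction n)
    case (Suc n)
    have co: "(\<lambda>\<omega>. \<omega> (n, s)) \<in> measurable ?M (count_space UNIV)" for s
      using measurable_component_singleton[OF UNIV_I, of "(n, s)" "\<lambda>i. measure_pmf (row_pmf q (snd i))"]
      unfolding measurable_pmf_measure2 .
    have "(\<lambda>\<omega>. (\<lambda>s \<omega>. \<omega> (n, s)) (driven_chain j \<omega> n) \<omega>) \<in> measurable ?M (count_space UNIV)"
      by (rule measurable_compose_countable[where f = "\<lambda>s \<omega>. \<omega> (n, s)", OF co Suc])
    then show ?case by simp
  qed simp
  from measurable_paths[of "\<lambda>n \<omega>. driven_chain j \<omega> n", OF this] show ?thesis .
qed

lemma sets_chain_law [simp, measurable_cong]: "sets (chain_law q j) = sets paths"
  by (simp add: chain_law_def)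

lemma space_chain_law [simp]: "space (chain_law q j) = UNIV"
  by (simp add: chain_law_def)

lemma prob_space_chain_law: "prob_space (chain_law q j)"
proof -
  interpret product_prob_space "\<lambda>i::nat \<times> _. measure_pmf (row_pmf q (snd i))" UNIV
    by (rule product_prob_spaceI) (auto simp: prob_space_measure_pmf)
  show ?thesis unfolding chain_law_def by (rule prob_space_distr[OF measurable_driven_chain])
qed

lemma emeasure_chain_law_cylinder:
  assumes q: "transition_matrix q"
  shows "emeasure (chain_law q j) {x. \<forall>k\<le>n. x k = y k} =
    ennreal (of_bool (y 0 = j) * (\<Prod>k<n. q (y k) (y (Suc k))))"
proof -
  let ?F = "\<lambda>i::nat \<times> _. measure_pmf (row_pmf q (snd i))"
  interpret product_prob_space ?F UNIV
    by (rule product_prob_spaceI) (auto simp: prob_space_measure_pmf)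
  define J where "J = (\<lambda>k. (k, y k)) ` {..<n}"
  have inj: "inj_on (\<lambda>k. (k, y k)) {..<n}" by (auto simp: inj_on_def)
  define S where "S = {x. \<forall>k\<le>n. x k = y k}"
  have eq: "\<omega> \<in> driven_chain j -` S \<longleftrightarrow> y 0 = j \<and> (\<forall>k<n. \<omega> (k, y k) = y (Suc k))" for \<omega>
  proof -
    have "(\<forall>k\<le>n. driven_chain j \<omega> k = y k) \<longleftrightarrow> y 0 = j \<and> (\<forall>k<n. \<omega> (k, y k) = y (Suc k))"
    proof (induction n)
      case (Suc n)
      show ?case
        using Suc by (auto simp: le_Suc_eq less_Suc_eq)
    qed auto
    then show ?thesis by (simp add: S_def)
  qed
  have sp: "space (Pi\<^sub>M UNIV ?F) = UNIV" by (auto simp: space_PiM PiE_def)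
  have "S \<in> sets paths"
  proof -
    have "Measurable.pred paths (\<lambda>x. \<forall>k\<le>n. x k = y k)" by measurable
    then show ?thesis unfolding S_def pred_def by simp
  qed
  then have *: "emeasure (chain_law q j) S = emeasure (Pi\<^sub>M UNIV ?F) (driven_chain j -` S)"
    unfolding chain_law_def using measurable_driven_chain by (subst emeasure_distr) (auto simp: sp)
  show ?thesis
  proof (cases "y 0 = j")
    case True
    have "driven_chain j -` S = {\<omega>\<in>space (Pi\<^sub>M UNIV ?F). \<forall>i\<in>J. \<omega> i \<in> {y (Suc (fst i))}}"
      unfolding J_def sp set_eq_iff eq using True by auto
    then have "emeasure (Pi\<^sub>M UNIV ?F) (driven_chain j -` S) =
        (\<Prod>i\<in>J. emeasure (?F i) {y (Suc (fst i))})"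
      using emeasure_PiM_Collect[of J "\<lambda>i. {y (Suc (fst i))}"] by (simp add: J_def)
    moreover have "(\<Prod>i\<in>J. emeasure (?F i) {y (Suc (fst i))}) = (\<Prod>k<n. ennreal (q (y k) (y (Suc k))))"
      unfolding J_def by (subst prod.reindex[OF inj]) (simp add: emeasure_pmf_single pmf_row_pmf[OF q])
    moreover have "(\<Prod>k<n. ennreal (q (y k) (y (Suc k)))) = ennreal (\<Prod>k<n. q (y k) (y (Suc k)))"
      using q by (intro prod_ennreal) (auto simp: transition_matrix_def)
    ultimately show ?thesis unfolding S_def[symmetric] * using True by simp
  next
    case False
    then have "driven_chain j -` S = {}" using eq by blast
    then show ?thesis unfolding S_def[symmetric] * using False by simp
  qed
qed

lemma sets_path_event [measurable]:
  "finite W \<Longrightarrow> {x. \<forall>t\<in>W. x t = y t} \<in> sets (paths :: ('t \<Rightarrow> 's::countable) measure)"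
proof -
  assume "finite W"
  then have "Measurable.pred paths (\<lambda>x::'t \<Rightarrow> 's. \<forall>t\<in>W. x t = y t)" by measurable
  then show ?thesis unfolding pred_def by simp
qed

lemma markov_chain_cylinder:
  assumes mc: "markov_chain M Y q" and q: "transition_matrix q" and j: "AE \<omega> in M. Y 0 \<omega> = j"
  shows "\<P>(\<omega> in M. \<forall>k\<le>n. Y k \<omega> = y k) = of_bool (y 0 = j) * (\<Prod>k<n. q (y k) (y (Suc k)))"
proof -
  interpret prob_space M using mc by (simp add: markov_chain_def)
  have [measurable]: "\<And>n. Y n \<in> measurable M (count_space UNIV)" using mc by (simp add: markov_chain_def)
  show ?thesis
  proof (induction n)
    case 0
    have "\<P>(\<omega> in M. Y 0 \<omega> = y 0) = \<P>(\<omega> in M. y 0 = j)"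
      by (rule prob_eq_AE) (use j in auto)
    then show ?case by (simp add: prob_space)
  next
    case (Suc n)
    let ?E = "\<P>(\<omega> in M. \<forall>k\<le>n. Y k \<omega> = y k)"
    have eq: "\<P>(\<omega> in M. \<forall>k\<le>Suc n. Y k \<omega> = y k) =
      \<P>(\<omega> in M. Y (Suc n) \<omega> = y (Suc n) \<and> (\<forall>k\<le>n. Y k \<omega> = y k))"
      by (intro arg_cong[where f="measure M"]) (auto simp: le_Suc_eq)
    show ?case
    proof (cases "?E > 0")
      case True
      then have "cond_prob M (\<lambda>\<omega>. Y (Suc n) \<omega> = y (Suc n)) (\<lambda>\<omega>. \<forall>k\<le>n. Y k \<omega> = y k) = q (y n) (y (Suc n))"
        using mc by (auto simp: markov_chain_def)
      then show ?thesis using True unfolding eq cond_prob_def Suc[symmetric] prod.lessThan_Suc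
        by (simp add: field_simps Suc[symmetric])
    next
      \<comment> \<open>Here \<open>markov_chain\<close> says nothing about the next step, but both
        sides vanish: the longer event lies in a null event, and the longer product contains the
        vanishing shorter one.\<close>
      case False
      then have z: "?E = 0" by (simp add: zero_less_measure_iff)
      have "\<P>(\<omega> in M. \<forall>k\<le>Suc n. Y k \<omega> = y k) \<le> ?E"
        unfolding eq by (intro finite_measure_mono) auto
      then have "\<P>(\<omega> in M. \<forall>k\<le>Suc n. Y k \<omega> = y k) = 0"
        using z measure_nonneg[of M "{\<omega>\<in>space M. \<forall>k\<le>Suc n. Y k \<omega> = y k}"] by linarith
      then show ?thesis using z Suc by auto
    qed
  qed
qed

lemma emeasure_distr_cylinder:
  fixes Y :: "'t \<Rightarrow> 'w \<Rightarrow> 's::countable"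
  assumes "\<And>t. Y t \<in> measurable M (count_space UNIV)" "finite W"
  shows "emeasure (distr M paths (\<lambda>\<omega> t. Y t \<omega>)) {x. \<forall>t\<in>W. x t = y t} =
    emeasure M {\<omega>\<in>space M. \<forall>t\<in>W. Y t \<omega> = y t}"
  using measurable_paths[of Y M, OF assms(1)] sets_path_event[OF assms(2), of y]
  by (subst emeasure_distr) (auto intro!: arg_cong[where f="emeasure M"])

lemma chain_law_eqI:
  assumes q: "transition_matrix q" and N: "sets N = sets paths" "prob_space N"
    and cyl: "\<And>n y. emeasure N {x. \<forall>k\<le>n. x k = y k} =
      ennreal (of_bool (y 0 = j) * (\<Prod>k<n. q (y k) (y (Suc k))))"
  shows "N = chain_law q j"
proof (rule paths_measure_eqI)
  show "finite_measure N" using N(2) by (simp add: prob_space_def)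
  fix J :: "nat set" assume "finite J"
  then obtain n where "J \<subseteq> {..n}" by (auto simp: finite_nat_set_iff_bounded_le)
  then show "\<exists>W. finite W \<and> J \<subseteq> W \<and> (\<forall>y. emeasure N {x. \<forall>t\<in>W. x t = y t} =
      emeasure (chain_law q j) {x. \<forall>t\<in>W. x t = y t})"
    using cyl emeasure_chain_law_cylinder[OF q] by (intro exI[of _ "{..n}"]) (simp add: Ball_def)
qed (use N in auto)

lemma markov_chain_distr:
  assumes mc: "markov_chain M Y q" and q: "transition_matrix q" and j: "AE \<omega> in M. Y 0 \<omega> = j"
  shows "distr M paths (\<lambda>\<omega> n. Y n \<omega>) = chain_law q j"
proof (rule chain_law_eqI[OF q])
  interpret prob_space M using mc by (simp add: markov_chain_def)
  have Y: "\<And>n. Y n \<in> measurable M (count_space UNIV)" using mc by (simp add: markov_chain_def)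
  show "prob_space (distr M paths (\<lambda>\<omega> n. Y n \<omega>))"
    using measurable_paths[of Y M, OF Y] by (rule prob_space_distr)
  fix n y
  show "emeasure (distr M paths (\<lambda>\<omega> n. Y n \<omega>)) {x. \<forall>k\<le>n. x k = y k} =
      ennreal (of_bool (y 0 = j) * (\<Prod>k<n. q (y k) (y (Suc k))))"
    using emeasure_distr_cylinder[where Y = Y, OF Y, where W = "{..n}" and y = y] markov_chain_cylinder[OF assms, of n y]
    by (simp add: emeasure_eq_measure Ball_def)
qed simp

text \<open>Converse of \<open>markov_chain_distr\<close>: for a fixed starting state, being a
  Markov chain is a property of the path law alone, so it can be transported between probability
  spaces.\<close>

lemma markov_chainI:
  assumes "prob_space M" and Y: "\<And>n. Y n \<in> measurable M (count_space UNIV)"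
    and q: "transition_matrix q" and d: "distr M paths (\<lambda>\<omega> n. Y n \<omega>) = chain_law q j"
  shows "markov_chain M Y q"
  unfolding markov_chain_def
proof (intro conjI allI impI assms)
  interpret prob_space M by fact
  have cyl: "\<P>(\<omega> in M. \<forall>k\<le>n. Y k \<omega> = y k) = of_bool (y 0 = j) * (\<Prod>k<n. q (y k) (y (Suc k)))" for n y
  proof -
    have "ennreal (\<P>(\<omega> in M. \<forall>k\<le>n. Y k \<omega> = y k)) = ennreal (of_bool (y 0 = j) * (\<Prod>k<n. q (y k) (y (Suc k))))"
      using emeasure_distr_cylinder[where Y = Y, OF Y, where W = "{..n}" and y = y] emeasure_chain_law_cylinder[OF q, of j n y] unfolding d
      by (simp add: emeasure_eq_measure Ball_def)
    moreover have "0 \<le> (\<Prod>k<n. q (y k) (y (Suc k)))"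
      using q by (intro prod_nonneg) (simp add: transition_matrix_def)
    ultimately show ?thesis by (subst (asm) ennreal_inj) auto
  qed
  fix n x y assume pos: "\<P>(\<omega> in M. \<forall>k\<le>n. Y k \<omega> = x k) > 0"
  have "(\<forall>k\<le>Suc n. Y k \<omega> = (x(Suc n := y)) k) \<longleftrightarrow> Y (Suc n) \<omega> = y \<and> (\<forall>k\<le>n. Y k \<omega> = x k)" for \<omega>
    by (auto simp: le_Suc_eq)
  then have "\<P>(\<omega> in M. Y (Suc n) \<omega> = y \<and> (\<forall>k\<le>n. Y k \<omega> = x k)) =
      of_bool (x 0 = j) * (\<Prod>k<n. q (x k) (x (Suc k))) * q (x n) y"
    using cyl[of "Suc n" "x(Suc n := y)"] by simp
  then show "cond_prob M (\<lambda>\<omega>. Y (Suc n) \<omega> = y) (\<lambda>\<omega>. \<forall>k\<le>n. Y k \<omega> = x k) = q (x n) y"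
    unfolding cond_prob_def cyl
    by (simp only:, intro nonzero_mult_div_cancel_left) (use pos in \<open>simp only: cyl\<close>)
qed

lemma AE_chain_law_start:
  assumes "transition_matrix q"
  shows "AE x in chain_law q j. x 0 = j"
proof -
  interpret prob_space "chain_law q j" by (rule prob_space_chain_law)
  have "emeasure (chain_law q j) {x. x 0 = j} = 1"
    using emeasure_chain_law_cylinder[OF assms, of j 0 "\<lambda>_. j"] by simp
  then have "AE x in chain_law q j. x \<in> {x. x 0 = j}"
    by (intro AE_prob_1) (simp add: emeasure_eq_measure)
  then show ?thesis by simp
qed

section \<open>Gluing a forward and a backward path at time 0\<close>

definition glue_paths :: "(nat \<Rightarrow> 's) \<times> (nat \<Rightarrow> 's) \<Rightarrow> int \<Rightarrow> 's" where
  "glue_paths fb n = (if 0 \<le> n then fst fb (nat n) else snd fb (nat (- n)))"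

definition split_path :: "(int \<Rightarrow> 's) \<Rightarrow> (nat \<Rightarrow> 's) \<times> (nat \<Rightarrow> 's)" where
  "split_path x = (\<lambda>n. x (int n), \<lambda>n. x (- int n))"

lemma measurable_glue_paths [measurable]: "glue_paths \<in> measurable (paths \<Otimes>\<^sub>M paths) paths"
proof -
  have "(\<lambda>fb. glue_paths fb n) \<in> measurable (paths \<Otimes>\<^sub>M paths) (count_space UNIV)" for n
    unfolding glue_paths_def
    by (cases "0 \<le> n") (auto intro!: measurable_compose[OF measurable_fst measurable_coordinate_const]
      measurable_compose[OF measurable_snd measurable_coordinate_const])
  from measurable_paths[of "\<lambda>n fb. glue_paths fb n", OF this] show ?thesis .
qed

lemma measurable_split_path [measurable]: "split_path \<in> measurable paths (paths \<Otimes>\<^sub>M paths)"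
  unfolding split_path_def by (intro measurable_Pair measurable_paths measurable_coordinate_const)

definition two_sided_law :: "('s::countable \<Rightarrow> 's \<Rightarrow> real) \<Rightarrow> ('s \<Rightarrow> real) \<Rightarrow> 's \<Rightarrow> (int \<Rightarrow> 's) measure" where
  "two_sided_law p m j = distr (chain_law p j \<Otimes>\<^sub>M chain_law (dual_matrix m p) j) paths glue_paths"

lemma sets_two_sided_law [simp, measurable_cong]: "sets (two_sided_law p m j) = sets paths"
  by (simp add: two_sided_law_def)

lemma space_two_sided_law [simp]: "space (two_sided_law p m j) = UNIV"
  by (simp add: two_sided_law_def)

lemma sets_pair_chain_law: "sets (chain_law p j \<Otimes>\<^sub>M chain_law q j) = sets (paths \<Otimes>\<^sub>M paths)"
  by (rule sets_pair_measure_cong) simp_all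

lemma measurable_glue_paths' [measurable]:
  "glue_paths \<in> measurable (chain_law p j \<Otimes>\<^sub>M chain_law q j) paths"
  using measurable_glue_paths measurable_cong_sets[OF sets_pair_chain_law refl] by blast

lemma prob_space_two_sided_law: "prob_space (two_sided_law p m j)"
proof -
  interpret pair_prob_space "chain_law p j" "chain_law (dual_matrix m p) j"
    by (simp add: pair_prob_space_def pair_sigma_finite_def prob_space_chain_law prob_space_imp_sigma_finite)
  show ?thesis unfolding two_sided_law_def by (rule prob_space_distr) measurable
qed

lemma transition_matrix_dual:
  assumes p: "transition_matrix p" and m: "stationary_measure p m"
  shows "transition_matrix (dual_matrix m p)"
  unfolding transition_matrix_def
proof (intro conjI allI)
  have pos: "0 < m j" for j using m by (simp add: stationary_measure_def)
  show "0 \<le> dual_matrix m p j k" for j k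
    using p less_imp_le[OF pos] by (simp add: dual_matrix_def transition_matrix_def)
  fix j
  have "((\<lambda>k. m k * p k j) has_sum m j) UNIV" using m by (simp add: stationary_measure_def)
  from has_sum_cmult_right[OF this, of "1 / m j"]
  show "(dual_matrix m p j has_sum 1) UNIV"
    using pos[of j] by (simp add: dual_matrix_def[abs_def])
qed

text \<open>Both halves carry a value at time 0 and gluing keeps only the one of the forward half.
  Splitting therefore recovers the pair only where the two values agree, which is almost sure as
  both chains start in \<open>j\<close>.\<close>

lemma distr_split_two_sided_law:
  assumes p: "transition_matrix p" and m: "stationary_measure p m"
  shows "distr (two_sided_law p m j) (paths \<Otimes>\<^sub>M paths) split_path =
    chain_law p j \<Otimes>\<^sub>M chain_law (dual_matrix m p) j"
proof -
  let ?F = "chain_law p j" and ?B = "chain_law (dual_matrix m p) j"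
  interpret pair_prob_space ?F ?B
    by (simp add: pair_prob_space_def pair_sigma_finite_def prob_space_chain_law prob_space_imp_sigma_finite)
  have "AE fb in ?F \<Otimes>\<^sub>M ?B. fst fb 0 = j \<and> snd fb 0 = j"
  proof (rule AE_pair_measure)
    have [measurable]: "Measurable.pred (?F \<Otimes>\<^sub>M ?B) (\<lambda>fb. fst fb 0 = j)" "Measurable.pred (?F \<Otimes>\<^sub>M ?B) (\<lambda>fb. snd fb 0 = j)"
      by (auto intro!: measurable_compose[OF measurable_compose[OF measurable_fst]] measurable_compose[OF measurable_compose[OF measurable_snd]]
         measurable_coordinate_const simp: measurable_cong_sets[OF sets_chain_law refl])
    show "{fb \<in> space (?F \<Otimes>\<^sub>M ?B). fst fb 0 = j \<and> snd fb 0 = j} \<in> sets (?F \<Otimes>\<^sub>M ?B)" by measurable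
    show "AE x in ?F. AE y in ?B. fst (x, y) 0 = j \<and> snd (x, y) 0 = j"
      using AE_chain_law_start[OF p] AE_chain_law_start[OF transition_matrix_dual[OF assms]] by auto
  qed
  then have "AE fb in ?F \<Otimes>\<^sub>M ?B. split_path (glue_paths fb) = fb"
  proof (rule AE_mp, intro AE_I2 impI)
    fix fb :: "(nat \<Rightarrow> 'a) \<times> (nat \<Rightarrow> 'a)" assume "fst fb 0 = j \<and> snd fb 0 = j"
    then show "split_path (glue_paths fb) = fb"
      by (cases fb) (auto simp: split_path_def glue_paths_def fun_eq_iff)
  qed
  then have "distr (?F \<Otimes>\<^sub>M ?B) (paths \<Otimes>\<^sub>M paths) (split_path \<circ> glue_paths) = distr (?F \<Otimes>\<^sub>M ?B) (paths \<Otimes>\<^sub>M paths) (\<lambda>x. x)"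
    by (intro distr_cong_AE) (auto simp: measurable_cong_sets[OF sets_pair_chain_law refl] intro!: measurable_comp[OF measurable_glue_paths measurable_split_path])
  also have "\<dots> = ?F \<Otimes>\<^sub>M ?B" using sets_pair_chain_law by (intro distr_id2) simp
  finally show ?thesis
    unfolding two_sided_law_def by (subst distr_distr) (auto intro: measurable_glue_paths' measurable_split_path)
qed

subsection \<open>Two-sided chains\<close>

text \<open>With \<open>two_sided_markov_chainI\<close> as converse, this replaces conditioning and
  independence by one identity for the joint law of \<open>X 0\<close> and the path. In this form
  the definition can be compared with mass transport, state by state.\<close>

lemma two_sided_markov_chain_law:
  assumes p: "transition_matrix p" and m: "stationary_measure p m"
    and X: "two_sided_markov_chain M X p m \<nu>" and B: "B \<in> sets paths"
  shows "emeasure M {\<omega>\<in>space M. X 0 \<omega> = j \<and> (\<lambda>n. X n \<omega>) \<in> B} =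
    ennreal (pmf \<nu> j) * emeasure (two_sided_law p m j) B"
proof -
  interpret prob_space M using X by (simp add: two_sided_markov_chain_def)
  have meas: "\<And>n. X n \<in> measurable M (count_space UNIV)" using X by (simp add: two_sided_markov_chain_def)
  note [measurable] = meas
  have Xp [measurable]: "(\<lambda>\<omega> n. X n \<omega>) \<in> measurable M paths"
    using measurable_paths[of X M, OF meas] .
  define A where "A = {\<omega>\<in>space M. X 0 \<omega> = j}"
  have A [measurable]: "A \<in> sets M" unfolding A_def by measurable
  have "emeasure (distr M (count_space UNIV) (X 0)) {j} = pmf \<nu> j"
    using X by (simp add: two_sided_markov_chain_def emeasure_pmf_single)
  moreover have "X 0 -` {j} \<inter> space M = A" by (auto simp: A_def)
  ultimately have emA: "emeasure M A = pmf \<nu> j"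
    by (subst (asm) emeasure_distr) auto
  have eq: "{\<omega>\<in>space M. X 0 \<omega> = j \<and> (\<lambda>n. X n \<omega>) \<in> B} = A \<inter> ((\<lambda>\<omega> n. X n \<omega>) -` B \<inter> space M)"
    by (auto simp: A_def)
  show ?thesis
  proof (cases "j \<in> set_pmf \<nu>")
    case False
    then have "emeasure M A = 0" using emA by (simp add: set_pmf_iff)
    moreover have "emeasure M (A \<inter> ((\<lambda>\<omega> n. X n \<omega>) -` B \<inter> space M)) \<le> emeasure M A"
      by (intro emeasure_mono) auto
    ultimately show ?thesis unfolding eq using emA by simp
  next
    case True
    define Mj where "Mj = uniform_measure M A"
    let ?F = "chain_law p j" and ?B = "chain_law (dual_matrix m p) j"
    let ?f = "\<lambda>\<omega> n. X (int n) \<omega>" and ?b = "\<lambda>\<omega> n. X (- int n) \<omega>"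
    have pos: "emeasure M A \<noteq> 0" using emA True by (simp add: set_pmf_iff pmf_positive)
    have Mj: "markov_chain Mj (\<lambda>n. X (int n)) p" "markov_chain Mj (\<lambda>n. X (- int n)) (dual_matrix m p)"
        "prob_space.indep_var Mj paths ?f paths ?b"
      using X True unfolding two_sided_markov_chain_def Let_def Mj_def A_def by blast+
    interpret Mj: prob_space Mj using Mj(1) by (simp add: markov_chain_def)
    have [measurable_cong, simp]: "sets Mj = sets M" by (simp add: Mj_def)
    have start: "AE \<omega> in Mj. X 0 \<omega> = j"
      unfolding Mj_def by (rule AE_uniform_measureI) (auto simp: A_def)
    have "distr Mj paths ?f = ?F"
      by (rule markov_chain_distr[OF Mj(1) p]) (use start in simp)
    moreover have "distr Mj paths ?b = ?B"
      by (rule markov_chain_distr[OF Mj(2) transition_matrix_dual[OF p m]]) (use start in simp)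
    ultimately have pair: "distr Mj (paths \<Otimes>\<^sub>M paths) (\<lambda>\<omega>. (?f \<omega>, ?b \<omega>)) = ?F \<Otimes>\<^sub>M ?B"
      using Mj(3) unfolding Mj.indep_var_distribution_eq by simp
    have f: "?f \<in> measurable Mj paths" and b: "?b \<in> measurable Mj paths"
      using Mj(3) unfolding Mj.indep_var_distribution_eq by simp_all
    have "two_sided_law p m j = distr (distr Mj (paths \<Otimes>\<^sub>M paths) (\<lambda>\<omega>. (?f \<omega>, ?b \<omega>))) paths glue_paths"
      unfolding two_sided_law_def pair ..
    also have "\<dots> = distr Mj paths (glue_paths \<circ> (\<lambda>\<omega>. (?f \<omega>, ?b \<omega>)))"
      using f b by (intro distr_distr measurable_Pair) auto
    also have "glue_paths \<circ> (\<lambda>\<omega>. (?f \<omega>, ?b \<omega>)) = (\<lambda>\<omega> n. X n \<omega>)"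
      by (auto simp: glue_paths_def fun_eq_iff)
    finally have "emeasure (two_sided_law p m j) B = emeasure (distr Mj paths (\<lambda>\<omega> n. X n \<omega>)) B" by simp
    also have "\<dots> = emeasure Mj ((\<lambda>\<omega> n. X n \<omega>) -` B \<inter> space M)"
      using B by (subst emeasure_distr) (auto simp: Mj_def)
    also have "\<dots> = emeasure M (A \<inter> ((\<lambda>\<omega> n. X n \<omega>) -` B \<inter> space M)) / emeasure M A"
      unfolding Mj_def using B by (intro emeasure_uniform_measure) auto
    finally have "emeasure (two_sided_law p m j) B = emeasure M (A \<inter> ((\<lambda>\<omega> n. X n \<omega>) -` B \<inter> space M)) / emeasure M A" .
    then show ?thesis unfolding eq emA[symmetric] ennreal_times_divide[symmetric] using pos
      by (simp add: ennreal_times_divide mult.commute[of "emeasure M A"] ennreal_mult_divide_eq)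
  qed
qed

lemma two_sided_markov_chainI:
  assumes p: "transition_matrix p" and m: "stationary_measure p m"
    and M: "prob_space M" and meas: "\<And>n. X n \<in> measurable M (count_space UNIV)"
    and law: "\<And>j B. B \<in> sets paths \<Longrightarrow> emeasure M {\<omega>\<in>space M. X 0 \<omega> = j \<and> (\<lambda>n. X n \<omega>) \<in> B} =
      ennreal (pmf \<nu> j) * emeasure (two_sided_law p m j) B"
  shows "two_sided_markov_chain M X p m \<nu>"
  unfolding two_sided_markov_chain_def Let_def
proof (intro conjI allI ballI M meas)
  interpret prob_space M by fact
  note [measurable] = meas
  have Xp [measurable]: "(\<lambda>\<omega> n. X n \<omega>) \<in> measurable M paths"
    using measurable_paths[of X M, OF meas] .
  have one: "emeasure (two_sided_law p m j) UNIV = 1" for j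
    using prob_space.emeasure_space_1[OF prob_space_two_sided_law, of p m j] by simp
  have emA: "emeasure M {\<omega>\<in>space M. X 0 \<omega> = j} = pmf \<nu> j" for j
    using law[of UNIV j] one by (simp add: sets.top[of paths, simplified])
  show "distr M (count_space UNIV) (X 0) = measure_pmf \<nu>"
  proof (rule measure_eqI_countable[of _ UNIV])
    fix j
    have "X 0 -` {j} \<inter> space M = {\<omega>\<in>space M. X 0 \<omega> = j}" by auto
    then show "emeasure (distr M (count_space UNIV) (X 0)) {j} = emeasure (measure_pmf \<nu>) {j}"
      using emA[of j] by (subst emeasure_distr) (auto simp: emeasure_pmf_single)
  qed auto
  fix j assume j: "j \<in> set_pmf \<nu>"
  define A where "A = {\<omega>\<in>space M. X 0 \<omega> = j}"
  define Mj where "Mj = uniform_measure M A"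
  have A [measurable]: "A \<in> sets M" unfolding A_def by measurable
  have pos: "emeasure M A \<noteq> 0" using emA j by (simp add: A_def set_pmf_iff pmf_positive)
  have Mj: "prob_space Mj" unfolding Mj_def by (rule prob_space_uniform_measure) (use pos in auto)
  interpret Mj: prob_space Mj by (rule Mj)
  have [measurable_cong, simp]: "sets Mj = sets M" by (simp add: Mj_def)
  let ?F = "chain_law p j" and ?B = "chain_law (dual_matrix m p) j"
  let ?f = "\<lambda>\<omega> n. X (int n) \<omega>" and ?b = "\<lambda>\<omega> n. X (- int n) \<omega>"
  have f: "?f \<in> measurable Mj paths"
    by (rule measurable_paths) simp
  have b: "?b \<in> measurable Mj paths"
    by (rule measurable_paths) simp
  have "distr Mj paths (\<lambda>\<omega> n. X n \<omega>) = two_sided_law p m j"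
  proof (rule measure_eqI)
    fix B assume "B \<in> sets (distr Mj paths (\<lambda>\<omega> n. X n \<omega>))"
    then have B [measurable]: "B \<in> sets paths" by simp
    have "emeasure (distr Mj paths (\<lambda>\<omega> n. X n \<omega>)) B = emeasure Mj ((\<lambda>\<omega> n. X n \<omega>) -` B \<inter> space M)"
      by (subst emeasure_distr) (auto simp: Mj_def)
    also have "\<dots> = emeasure M (A \<inter> ((\<lambda>\<omega> n. X n \<omega>) -` B \<inter> space M)) / emeasure M A"
      unfolding Mj_def using B by (intro emeasure_uniform_measure) auto
    also have "A \<inter> ((\<lambda>\<omega> n. X n \<omega>) -` B \<inter> space M) = {\<omega>\<in>space M. X 0 \<omega> = j \<and> (\<lambda>n. X n \<omega>) \<in> B}"
      by (auto simp: A_def)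
    also have "emeasure M \<dots> / emeasure M A = emeasure (two_sided_law p m j) B"
      using pos unfolding law[OF B] A_def emA
      by (subst mult.commute, intro ennreal_mult_divide_eq) auto
    finally show "emeasure (distr Mj paths (\<lambda>\<omega> n. X n \<omega>)) B = emeasure (two_sided_law p m j) B" .
  qed simp
  then have "?F \<Otimes>\<^sub>M ?B = distr (distr Mj paths (\<lambda>\<omega> n. X n \<omega>)) (paths \<Otimes>\<^sub>M paths) split_path"
    using distr_split_two_sided_law[OF p m, of j] by simp
  also have "\<dots> = distr Mj (paths \<Otimes>\<^sub>M paths) (\<lambda>\<omega>. (?f \<omega>, ?b \<omega>))"
    by (subst distr_distr) (auto simp: comp_def split_path_def intro: measurable_split_path)
  finally have pair: "distr Mj (paths \<Otimes>\<^sub>M paths) (\<lambda>\<omega>. (?f \<omega>, ?b \<omega>)) = ?F \<Otimes>\<^sub>M ?B" by simp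
  interpret F: prob_space ?F by (rule prob_space_chain_law)
  interpret B: prob_space ?B by (rule prob_space_chain_law)
  interpret FB: pair_prob_space ?F ?B ..
  have F: "distr Mj paths ?f = ?F"
  proof -
    have "distr Mj paths ?f = distr (distr Mj (paths \<Otimes>\<^sub>M paths) (\<lambda>\<omega>. (?f \<omega>, ?b \<omega>))) paths fst"
      using f b by (subst distr_distr) (auto simp: comp_def)
    also have "\<dots> = distr (?F \<Otimes>\<^sub>M ?B) ?F fst" unfolding pair by (rule distr_cong) auto
    also have "\<dots> = ?F" by (rule B.distr_pair_fst)
    finally show ?thesis .
  qed
  have B: "distr Mj paths ?b = ?B"
  proof -
    have "distr Mj paths ?b = distr (distr Mj (paths \<Otimes>\<^sub>M paths) (\<lambda>\<omega>. (?f \<omega>, ?b \<omega>))) paths snd"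
      using f b by (subst distr_distr) (auto simp: comp_def)
    also have "\<dots> = distr (?F \<Otimes>\<^sub>M ?B) ?B snd" unfolding pair by (rule distr_cong) auto
    also have "\<dots> = ?B"
    proof (rule measure_eqI)
      fix S assume "S \<in> sets (distr (?F \<Otimes>\<^sub>M ?B) ?B snd)"
      then have S: "S \<in> sets ?B" by simp
      have "emeasure (distr (?F \<Otimes>\<^sub>M ?B) ?B snd) S = emeasure (?F \<Otimes>\<^sub>M ?B) (space ?F \<times> S)"
        using S sets.sets_into_space[OF S]
        by (subst emeasure_distr) (auto simp: space_pair_measure intro!: arg_cong[where f="emeasure _"])
      also have "\<dots> = emeasure ?F (space ?F) * emeasure ?B S"
        using S by (intro B.emeasure_pair_measure_Times sets.top)
      also have "\<dots> = emeasure ?B S" unfolding F.emeasure_space_1 by simp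
      finally show "emeasure (distr (?F \<Otimes>\<^sub>M ?B) ?B snd) S = emeasure ?B S" .
    qed simp
    finally show ?thesis .
  qed
  show "markov_chain (uniform_measure M {\<omega> \<in> space M. X 0 \<omega> = j}) (\<lambda>n. X (int n)) p"
    using markov_chainI[OF Mj _ p F] by (simp add: A_def Mj_def)
  show "markov_chain (uniform_measure M {\<omega> \<in> space M. X 0 \<omega> = j}) (\<lambda>n. X (- int n)) (dual_matrix m p)"
    using markov_chainI[OF Mj _ transition_matrix_dual[OF p m] B] by (simp add: A_def Mj_def)
  show "prob_space.indep_var (uniform_measure M {\<omega> \<in> space M. X 0 \<omega> = j}) paths ?f paths ?b"
    using f b F B pair unfolding Mj.indep_var_distribution_eq A_def[symmetric] Mj_def[symmetric] by simp
qed

subsection \<open>Shift invariance and mass transport\<close>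

lemma emeasure_two_sided_law_split:
  assumes p: "transition_matrix p" and m: "stationary_measure p m"
  shows "emeasure (two_sided_law p m j) {x. \<forall>t\<in>{- int a..int b}. x t = y t} =
    ennreal (of_bool (y 0 = j) * ((\<Prod>k<b. p (y (int k)) (y (int k + 1))) *
      (\<Prod>k<a. dual_matrix m p (y (- int k)) (y (- int k - 1)))))"
proof -
  let ?F = "chain_law p j" and ?B = "chain_law (dual_matrix m p) j"
  note d = transition_matrix_dual[OF p m]
  interpret B: prob_space ?B by (rule prob_space_chain_law)
  let ?S = "{f. \<forall>k\<le>b. f k = y (int k)}" and ?T = "{f. \<forall>k\<le>a. f k = y (- int k)}"
  have S: "?S \<in> sets paths" and T: "?T \<in> sets paths"
    using sets_path_event[of "{..b}" "\<lambda>k. y (int k)"] sets_path_event[of "{..a}" "\<lambda>k. y (- int k)"]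
    by (simp_all add: Ball_def)
  have iff: "x \<in> {x. \<forall>t\<in>{- int a..int b}. x t = y t} \<longleftrightarrow> split_path x \<in> ?S \<times> ?T" for x
  proof -
    have "x t = y t" if "\<forall>k\<le>b. x (int k) = y (int k)" "\<forall>k\<le>a. x (- int k) = y (- int k)"
      "- int a \<le> t" "t \<le> int b" for t
    proof (cases "0 \<le> t")
      case True
      then show ?thesis using that(1)[rule_format, of "nat t"] that by simp
    next
      case False
      then show ?thesis using that(2)[rule_format, of "nat (- t)"] that by simp
    qed
    then show ?thesis by (auto simp: split_path_def)
  qed
  have "emeasure (two_sided_law p m j) {x. \<forall>t\<in>{- int a..int b}. x t = y t} =
    emeasure (distr (two_sided_law p m j) (paths \<Otimes>\<^sub>M paths) split_path) (?S \<times> ?T)"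
  proof -
    have sp: "split_path \<in> measurable (two_sided_law p m j) (paths \<Otimes>\<^sub>M paths)" by measurable
    have "split_path -` (?S \<times> ?T) = {x. \<forall>t\<in>{- int a..int b}. x t = y t}"
      unfolding set_eq_iff vimage_eq iff by (rule allI refl)+
    then show ?thesis unfolding emeasure_distr[OF sp pair_measureI[OF S T]] by (simp only: space_two_sided_law Int_UNIV_right)
  qed
  also have "\<dots> = emeasure (?F \<Otimes>\<^sub>M ?B) (?S \<times> ?T)"
    unfolding distr_split_two_sided_law[OF p m] ..
  also have "\<dots> = emeasure ?F ?S * emeasure ?B ?T"
    using S T by (intro B.emeasure_pair_measure_Times) auto
  also have "\<dots> = ennreal (of_bool (y 0 = j) * (\<Prod>k<b. p (y (int k)) (y (int (Suc k))))) *
      ennreal (of_bool (y (- int 0) = j) * (\<Prod>k<a. dual_matrix m p (y (- int k)) (y (- int (Suc k)))))"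
    unfolding emeasure_chain_law_cylinder[OF p] emeasure_chain_law_cylinder[OF d] by simp
  also have "\<dots> = ennreal ((of_bool (y 0 = j) * (\<Prod>k<b. p (y (int k)) (y (int (Suc k))))) *
      (of_bool (y (- int 0) = j) * (\<Prod>k<a. dual_matrix m p (y (- int k)) (y (- int (Suc k))))))"
    using p d by (intro ennreal_mult[symmetric] mult_nonneg_nonneg prod_nonneg) (auto simp: transition_matrix_def)
  finally have fin: "emeasure (two_sided_law p m j) {x. \<forall>t\<in>{- int a..int b}. x t = y t} =
    ennreal ((of_bool (y 0 = j) * (\<Prod>k<b. p (y (int k)) (y (int (Suc k))))) *
      (of_bool (y (- int 0) = j) * (\<Prod>k<a. dual_matrix m p (y (- int k)) (y (- int (Suc k))))))" .
  have e: "int (Suc k) = int k + 1" "- int (Suc k) = - int k - 1" for k by simp_all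
  show ?thesis using fin unfolding e by (cases "y 0 = j") simp_all
qed

lemma prod_int_interval_split:
  fixes f :: "int \<Rightarrow> 'a::comm_monoid_mult"
  shows "(\<Prod>t\<in>{- int a..<int b}. f t) = (\<Prod>k<b. f (int k)) * (\<Prod>k<a. f (- int k - 1))"
proof -
  have "{- int a..<int b} = int ` {..<b} \<union> (\<lambda>k. - int k - 1) ` {..<a}"
  proof (intro set_eqI iffI)
    fix t assume t: "t \<in> {- int a..<int b}"
    show "t \<in> int ` {..<b} \<union> (\<lambda>k. - int k - 1) ` {..<a}"
    proof (cases "0 \<le> t")
      case True
      then have "t = int (nat t)" "nat t < b" using t by auto
      then show ?thesis by blast
    next
      case False
      then have "t = - int (nat (- t - 1)) - 1" "nat (- t - 1) < a" using t by auto
      then show ?thesis by blast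
    qed
  qed auto
  moreover have "(\<Prod>t\<in>int ` {..<b} \<union> (\<lambda>k. - int k - 1) ` {..<a}. f t) =
      prod f (int ` {..<b}) * prod f ((\<lambda>k. - int k - 1) ` {..<a})"
    by (rule prod.union_disjoint) auto
  ultimately show ?thesis by (simp add: prod.reindex inj_on_def)
qed

text \<open>The source of shift invariance. The factor \<open>m j\<close> turns each backward step
  around, since \<open>m c * dual_matrix m p c d = m d * p d c\<close>, and so travels to the left
  end of the window. What remains is the weight of a forward path from \<open>y a\<close>, in which
  time 0 is visible only through the condition \<open>y 0 = j\<close>.\<close>

lemma stationary_weight_window:
  assumes p: "transition_matrix p" and m: "stationary_measure p m" and "a \<le> 0" "0 \<le> b"
  shows "ennreal (m j) * emeasure (two_sided_law p m j) {x. \<forall>t\<in>{a..b}. x t = y t} =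
    ennreal (of_bool (y 0 = j) * (m (y a) * (\<Prod>t\<in>{a..<b}. p (y t) (y (t + 1)))))"
proof -
  obtain a' b' where ab: "a = - int a'" "b = int b'"
    using assms(3,4) by (metis nonneg_int_cases nonpos_int_cases)
  have pos: "0 < m k" for k using m by (simp add: stationary_measure_def)
  have dual: "m (y 0) * (\<Prod>k<n. dual_matrix m p (y (- int k)) (y (- int k - 1))) =
      m (y (- int n)) * (\<Prod>k<n. p (y (- int k - 1)) (y (- int k)))" for n
  proof (induction n)
    case (Suc n)
    have "m (y 0) * (\<Prod>k<Suc n. dual_matrix m p (y (- int k)) (y (- int k - 1))) =
      m (y (- int n)) * (\<Prod>k<n. p (y (- int k - 1)) (y (- int k))) * dual_matrix m p (y (- int n)) (y (- int n - 1))"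
      unfolding prod.lessThan_Suc using Suc by (simp add: mult.assoc)
    also have "\<dots> = m (y (- int (Suc n))) * (\<Prod>k<Suc n. p (y (- int k - 1)) (y (- int k)))"
    proof -
      have e: "- int (Suc n) = - int n - 1" by simp
      have "m c * P * (m d / m c * p d c) = m d * (P * p d c)" for c d P
        using pos[of c] by simp
      then show ?thesis unfolding prod.lessThan_Suc dual_matrix_def e .
    qed
    finally show ?case .
  qed simp
  have "ennreal (m j) * emeasure (two_sided_law p m j) {x. \<forall>t\<in>{a..b}. x t = y t} =
     ennreal (m j * (of_bool (y 0 = j) * ((\<Prod>k<b'. p (y (int k)) (y (int k + 1))) *
      (\<Prod>k<a'. dual_matrix m p (y (- int k)) (y (- int k - 1))))))"
    unfolding ab emeasure_two_sided_law_split[OF p m]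
    using p transition_matrix_dual[OF p m] less_imp_le[OF pos]
    by (intro ennreal_mult[symmetric] mult_nonneg_nonneg prod_nonneg) (auto simp: transition_matrix_def)
  also have "m j * (of_bool (y 0 = j) * ((\<Prod>k<b'. p (y (int k)) (y (int k + 1))) *
      (\<Prod>k<a'. dual_matrix m p (y (- int k)) (y (- int k - 1))))) =
    of_bool (y 0 = j) * ((\<Prod>k<b'. p (y (int k)) (y (int k + 1))) *
     (m (y 0) * (\<Prod>k<a'. dual_matrix m p (y (- int k)) (y (- int k - 1)))))"
    by auto
  also have "\<dots> = of_bool (y 0 = j) * (m (y a) * (\<Prod>t\<in>{a..<b}. p (y t) (y (t + 1))))"
    unfolding dual ab prod_int_interval_split by (simp add: algebra_simps)
  finally show ?thesis .
qed

definition shift_path :: "int \<Rightarrow> (int \<Rightarrow> 's) \<Rightarrow> int \<Rightarrow> 's" where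
  "shift_path k x n = x (n + k)"

lemma measurable_shift_path [measurable]: "shift_path k \<in> measurable paths paths"
  unfolding shift_path_def[abs_def] by (intro measurable_paths measurable_coordinate_const)

text \<open>
  The infinite measure with density \<open>m\<close> with respect to the laws of the two-sided chains is shift invariant.
\<close>
lemma two_sided_law_shift:
  assumes p: "transition_matrix p" and m: "stationary_measure p m" and B: "B \<in> sets paths"
  shows "ennreal (m i) * emeasure (two_sided_law p m i) {x. x k = j \<and> shift_path k x \<in> B} =
    ennreal (m j) * emeasure (two_sided_law p m j) {x. x (- k) = i \<and> x \<in> B}"
proof -
  let ?I = "two_sided_law p m i" and ?J = "two_sided_law p m j"
  \<comment> \<open>Both sides of the claim as measures in \<open>B\<close>. They are finite, with
    mass at most \<open>m i\<close> and \<open>m j\<close>, so they can be compared on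
    cylinders.\<close>
  define M1 where "M1 = distr (density ?I (\<lambda>x. ennreal (m i) * indicator {x. x k = j} x)) paths (shift_path k)"
  define M2 where "M2 = density ?J (\<lambda>x. ennreal (m j) * indicator {x. x (- k) = i} x)"
  have set1 [measurable]: "{x. x l = s} \<in> sets (paths :: (int \<Rightarrow> 'a) measure)" for l s
    using sets_path_event[of "{l}" "\<lambda>_. s"] by simp
  interpret I: prob_space ?I by (rule prob_space_two_sided_law)
  interpret J: prob_space ?J by (rule prob_space_two_sided_law)
  have e1: "emeasure M1 B = ennreal (m i) * emeasure ?I {x. x k = j \<and> shift_path k x \<in> B}"
    if B: "B \<in> sets paths" for B
  proof -
    have [measurable]: "shift_path k -` B \<in> sets paths"
      using measurable_sets[OF measurable_shift_path B] by simp
    have "emeasure M1 B = emeasure (density ?I (\<lambda>x. ennreal (m i) * indicator {x. x k = j} x)) (shift_path k -` B)"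
      unfolding M1_def using B by (subst emeasure_distr) auto
    also have "\<dots> = (\<integral>\<^sup>+x. ennreal (m i) * indicator {x. x k = j \<and> shift_path k x \<in> B} x \<partial>?I)"
      by (subst emeasure_density) (auto intro!: nn_integral_cong split: split_indicator)
    also have "{x. x k = j \<and> shift_path k x \<in> B} = {x. x k = j} \<inter> shift_path k -` B" by auto
    also have "(\<integral>\<^sup>+x. ennreal (m i) * indicator ({x. x k = j} \<inter> shift_path k -` B) x \<partial>?I) =
      ennreal (m i) * emeasure ?I ({x. x k = j} \<inter> shift_path k -` B)"
      by (rule nn_integral_cmult_indicator) measurable
    finally show ?thesis by (simp add: Collect_conj_eq vimage_def)
  qed
  have e2: "emeasure M2 B = ennreal (m j) * emeasure ?J {x. x (- k) = i \<and> x \<in> B}"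
    if [measurable]: "B \<in> sets paths" for B
  proof -
    have "emeasure M2 B = (\<integral>\<^sup>+x. ennreal (m j) * indicator ({x. x (- k) = i} \<inter> B) x \<partial>?J)"
      unfolding M2_def by (subst emeasure_density) (auto intro!: nn_integral_cong split: split_indicator)
    also have "\<dots> = ennreal (m j) * emeasure ?J ({x. x (- k) = i} \<inter> B)"
      by (rule nn_integral_cmult_indicator) measurable
    finally show ?thesis by (simp add: Collect_conj_eq)
  qed
  have "M1 = M2"
  proof (rule paths_measure_eqI)
    show "finite_measure M1"
    proof
      have "emeasure M1 UNIV \<le> ennreal (m i) * 1"
        unfolding e1[OF sets.top[of paths, simplified]]
        by (intro mult_left_mono I.emeasure_le_1) auto
      then show "emeasure M1 (space M1) \<noteq> \<infinity>"
        by (auto simp: M1_def top_unique)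
    qed
    fix J :: "int set" assume "finite J"
    define n0 where "n0 = Max (insert 0 (abs ` J))"
    have n0: "J \<subseteq> {-n0..n0}"
    proof
      fix t assume "t \<in> J"
      then have "\<bar>t\<bar> \<le> n0" unfolding n0_def using \<open>finite J\<close> by (intro Max_ge) auto
      then show "t \<in> {-n0..n0}" by auto
    qed
    \<comment> \<open>The window must also contain \<open>- k\<close>, where the event
      \<open>x (- k) = i\<close> is read off, and after translation by \<open>k\<close> it must
      still contain 0 for \<open>stationary_weight_window\<close>.\<close>
    define n where "n = max n0 \<bar>k\<bar>"
    have n: "J \<subseteq> {-n..n}" "\<bar>k\<bar> \<le> n" using n0 by (force simp: n_def)+
    have "emeasure M1 {x. \<forall>t\<in>{-n..n}. x t = y t} = emeasure M2 {x. \<forall>t\<in>{-n..n}. x t = y t}" for y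
    proof -
      let ?C = "{x. \<forall>t\<in>{-n..n}. x t = y t}"
      define z where "z t = y (t - k)" for t
      have C: "?C \<in> sets paths" by (rule sets_path_event) simp
      have "{x. x k = j \<and> shift_path k x \<in> ?C} = (if y 0 = j then {x. \<forall>t\<in>{k - n..k + n}. x t = z t} else {})"
      proof -
        have 1: "(\<forall>t\<in>{-n..n}. x (t + k) = y t) \<longleftrightarrow> (\<forall>t\<in>{k - n..k + n}. x t = z t)" for x
        proof (intro iffI ballI)
          fix t assume "\<forall>t\<in>{-n..n}. x (t + k) = y t" "t \<in> {k - n..k + n}"
          then show "x t = z t" by (auto simp: z_def dest!: bspec[of _ _ "t - k"])
        next
          fix t assume "\<forall>t\<in>{k - n..k + n}. x t = z t" "t \<in> {-n..n}"
          then show "x (t + k) = y t" by (auto simp: z_def dest!: bspec[of _ _ "t + k"])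
        qed
        have 2: "x k = y 0" if "\<forall>t\<in>{-n..n}. x (t + k) = y t" for x
          using bspec[OF that, of 0] n by auto
        have "x k = j \<and> (\<forall>t\<in>{-n..n}. x (t + k) = y t) \<longleftrightarrow>
            y 0 = j \<and> (\<forall>t\<in>{k - n..k + n}. x t = z t)" for x
          using 1[of x] 2[of x] by argo
        then show ?thesis by (simp add: shift_path_def)
      qed
      then have "emeasure M1 ?C = of_bool (y 0 = j) * (ennreal (m i) * emeasure ?I {x. \<forall>t\<in>{k - n..k + n}. x t = z t})"
        unfolding e1[OF C] by simp
      also have "\<dots> = of_bool (y 0 = j) * ennreal (of_bool (z 0 = i) * (m (z (k - n)) * (\<Prod>t\<in>{k - n..<k + n}. p (z t) (z (t + 1)))))"
        by (subst stationary_weight_window[OF p m]) (use n in auto)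
      also have "(\<Prod>t\<in>{k - n..<k + n}. p (z t) (z (t + 1))) = (\<Prod>t\<in>{-n..<n}. p (y t) (y (t + 1)))"
        by (rule prod.reindex_bij_witness[of _ "\<lambda>t. t + k" "\<lambda>t. t - k"]) (auto simp: z_def algebra_simps)
      finally have 1: "emeasure M1 ?C = of_bool (y 0 = j) * ennreal (of_bool (y (- k) = i) * (m (y (- n)) * (\<Prod>t\<in>{-n..<n}. p (y t) (y (t + 1)))))"
        by (simp add: z_def)
      have "{x. x (- k) = i \<and> x \<in> ?C} = (if y (- k) = i then ?C else {})"
      proof -
        have "- k \<in> {-n..n}" using n by auto
        then have 3: "x (- k) = y (- k)" if "x \<in> ?C" for x
          using that by blast
        have "x (- k) = i \<and> x \<in> ?C \<longleftrightarrow> y (- k) = i \<and> x \<in> ?C" for x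
          using 3[of x] by argo
        then show ?thesis by simp
      qed
      then have "emeasure M2 ?C = of_bool (y (- k) = i) * (ennreal (m j) * emeasure ?J ?C)"
        unfolding e2[OF C] by simp
      also have "\<dots> = of_bool (y (- k) = i) * ennreal (of_bool (y 0 = j) * (m (y (- n)) * (\<Prod>t\<in>{- n..<n}. p (y t) (y (t + 1)))))"
        by (subst stationary_weight_window[OF p m]) (use n in auto)
      finally show ?thesis unfolding 1 by auto
    qed
    then show "\<exists>W. finite W \<and> J \<subseteq> W \<and> (\<forall>y. emeasure M1 {x. \<forall>t\<in>W. x t = y t} = emeasure M2 {x. \<forall>t\<in>W. x t = y t})"
      using n by (intro exI[of _ "{-n..n}"]) auto
  qed (auto simp: M1_def M2_def)
  then show ?thesis using e1[OF B] e2[OF B] by simp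
qed

lemma shift_path_inverse [simp]:
  "shift_path (- k) (shift_path k x) = x" "shift_path k (shift_path (- k) x) = x"
  by (auto simp: shift_path_def fun_eq_iff)

text \<open>
  If at each visit \<open>s\<close> to \<open>i\<close> one sends unit mass to the time \<open>s + \<tau>\<close> seen from \<open>s\<close>, then \<open>k \<in> arrivals i \<tau> x\<close>
  means that the mass sent at time \<open>- k\<close> arrives at time 0.
\<close>
definition arrivals :: "'s \<Rightarrow> ((int \<Rightarrow> 's) \<Rightarrow> int option) \<Rightarrow> (int \<Rightarrow> 's) \<Rightarrow> int set" where
  "arrivals i \<tau> x = {k. x (- k) = i \<and> \<tau> (shift_path (- k) x) = Some k}"

lemma sets_path_coordinate [measurable]: "{x. x t = s} \<in> sets (paths :: ('t \<Rightarrow> 's::countable) measure)"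
  using sets_path_event[of "{t}" "\<lambda>_. s"] by simp

lemma sets_arrivals [measurable]:
  assumes \<tau>: "\<tau> \<in> measurable paths (count_space UNIV)"
  shows "{x :: int \<Rightarrow> 's::countable. k \<in> arrivals i \<tau> x} \<in> sets paths"
proof -
  have "(\<lambda>x. \<tau> (shift_path (- k) x)) -` {Some k} \<inter> space paths \<in> sets paths"
    by (rule measurable_sets[OF measurable_compose[OF measurable_shift_path \<tau>]]) simp
  then have "{x. x (- k) = i} \<inter> ((\<lambda>x. \<tau> (shift_path (- k) x)) -` {Some k}) \<in> sets paths"
    by (intro sets.Int sets_path_coordinate) simp
  also have "{x. x (- k) = i} \<inter> ((\<lambda>x. \<tau> (shift_path (- k) x)) -` {Some k}) = {x. k \<in> arrivals i \<tau> x}"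
    by (auto simp: arrivals_def)
  finally show ?thesis .
qed

lemma measurable_card_arrivals:
  fixes \<tau> :: "(int \<Rightarrow> 's::countable) \<Rightarrow> int option"
  assumes \<tau>: "\<tau> \<in> measurable paths (count_space UNIV)"
  shows "(\<lambda>x. emeasure (count_space UNIV) (arrivals i \<tau> x)) \<in> borel_measurable paths"
proof -
  interpret sigma_finite_measure "count_space (UNIV :: int set)" by (rule sigma_finite_measure_count_space)
  have 1: "(\<lambda>p. indicator {x. k \<in> arrivals i \<tau> x} (fst p) :: ennreal)
      \<in> borel_measurable (paths \<Otimes>\<^sub>M count_space (UNIV :: int set))" for k
    by (rule measurable_compose[OF measurable_fst]) (rule borel_measurable_indicator, rule sets_arrivals[OF \<tau>])
  have "(\<lambda>p. indicator {x. snd p \<in> arrivals i \<tau> x} (fst p) :: ennreal)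
      \<in> borel_measurable (paths \<Otimes>\<^sub>M count_space (UNIV :: int set))"
    by (rule measurable_compose_countable[where f = "\<lambda>k p. indicator {x. k \<in> arrivals i \<tau> x} (fst p)", OF 1 measurable_snd])
  then have "(\<lambda>x. \<integral>\<^sup>+k. indicator {x. k \<in> arrivals i \<tau> x} x \<partial>count_space UNIV) \<in> borel_measurable paths"
    by (intro borel_measurable_nn_integral) (simp add: case_prod_beta')
  also have "(\<lambda>x. \<integral>\<^sup>+k. indicator {x. k \<in> arrivals i \<tau> x} x \<partial>count_space UNIV) =
      (\<lambda>x. \<integral>\<^sup>+k. indicator (arrivals i \<tau> x) k \<partial>count_space UNIV)"
    by (intro ext nn_integral_cong) (auto split: split_indicator)
  finally show ?thesis by simp
qed

lemma sets_shifted_event: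
  fixes \<tau> :: "(int \<Rightarrow> 's::countable) \<Rightarrow> int option"
  assumes \<tau>: "\<tau> \<in> measurable paths (count_space UNIV)" and B: "B \<in> sets paths"
  shows "{x. \<tau> x = Some k \<and> x k = j \<and> shift_path k x \<in> B} \<in> sets paths"
proof -
  have "\<tau> -` {Some k} \<in> sets paths" "shift_path k -` B \<in> sets paths"
    using measurable_sets[OF \<tau>, of "{Some k}"] measurable_sets[OF measurable_shift_path B] by simp_all
  then have "\<tau> -` {Some k} \<inter> ({x. x k = j} \<inter> shift_path k -` B) \<in> sets paths"
    by (intro sets.Int sets_path_coordinate)
  also have "\<tau> -` {Some k} \<inter> ({x. x k = j} \<inter> shift_path k -` B) = {x. \<tau> x = Some k \<and> x k = j \<and> shift_path k x \<in> B}"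
    by auto
  finally show ?thesis .
qed

text \<open>Split by the value \<open>k\<close> of the time and move each piece by
  \<open>two_sided_law_shift\<close>. Seen from time \<open>k\<close>, the starting visit to
  \<open>i\<close> lies at \<open>- k\<close>, so the condition \<open>\<tau> x = Some k\<close>
  becomes \<open>k \<in> arrivals i \<tau> x\<close>. Summing over \<open>k\<close> inside the
  integral counts the arrivals.\<close>

lemma mass_transport:
  fixes \<tau> :: "(int \<Rightarrow> 's::countable) \<Rightarrow> int option"
  assumes p: "transition_matrix p" and m: "stationary_measure p m"
    and \<tau>: "\<tau> \<in> measurable paths (count_space UNIV)" and B: "B \<in> sets paths"
  shows "ennreal (m i) * emeasure (two_sided_law p m i) {x. \<exists>k. \<tau> x = Some k \<and> x k = j \<and> shift_path k x \<in> B} =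
    ennreal (m j) * (\<integral>\<^sup>+x. emeasure (count_space UNIV) (arrivals i \<tau> x) * indicator B x \<partial>two_sided_law p m j)"
proof -
  define E where "E k = {x. \<tau> x = Some k \<and> x k = j \<and> shift_path k x \<in> B}" for k
  have E: "E k \<in> sets (two_sided_law p m i)" for k
    unfolding E_def using sets_shifted_event[OF \<tau> B] by simp
  have A: "{x. k \<in> arrivals i \<tau> x} \<inter> B \<in> sets (two_sided_law p m j)" for k
    using sets.Int[OF sets_arrivals[OF \<tau>] B] by simp
  have "{x. \<exists>k. \<tau> x = Some k \<and> x k = j \<and> shift_path k x \<in> B} = (\<Union>k. E k)"
    by (auto simp: E_def)
  then have "ennreal (m i) * emeasure (two_sided_law p m i) {x. \<exists>k. \<tau> x = Some k \<and> x k = j \<and> shift_path k x \<in> B}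
    = ennreal (m i) * (\<integral>\<^sup>+k. emeasure (two_sided_law p m i) (E k) \<partial>count_space UNIV)"
    using E by (subst emeasure_UN_countable[symmetric]) (auto simp: disjoint_family_on_def E_def)
  also have "\<dots> = (\<integral>\<^sup>+k. ennreal (m i) * emeasure (two_sided_law p m i) (E k) \<partial>count_space UNIV)"
    by (rule nn_integral_cmult[symmetric]) simp
  also have "\<dots> = (\<integral>\<^sup>+k. ennreal (m j) * emeasure (two_sided_law p m j) ({x. k \<in> arrivals i \<tau> x} \<inter> B) \<partial>count_space UNIV)"
  proof (rule nn_integral_cong)
    fix k :: int
    have "(\<lambda>x. \<tau> (shift_path (- k) x)) -` {Some k} \<in> sets paths"
      using measurable_sets[OF measurable_compose[OF measurable_shift_path \<tau>], of "{Some k}"] by simp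
    then have "((\<lambda>x. \<tau> (shift_path (- k) x)) -` {Some k}) \<inter> B \<in> sets paths"
      using B by (rule sets.Int)
    from two_sided_law_shift[OF p m this, of i k j]
    show "ennreal (m i) * emeasure (two_sided_law p m i) (E k) =
        ennreal (m j) * emeasure (two_sided_law p m j) ({x. k \<in> arrivals i \<tau> x} \<inter> B)"
      by (simp add: E_def arrivals_def Int_def conj_ac)
  qed
  also have "\<dots> = ennreal (m j) * (\<integral>\<^sup>+k. emeasure (two_sided_law p m j) ({x. k \<in> arrivals i \<tau> x} \<inter> B) \<partial>count_space UNIV)"
    by (rule nn_integral_cmult) simp
  also have "(\<integral>\<^sup>+k. emeasure (two_sided_law p m j) ({x. k \<in> arrivals i \<tau> x} \<inter> B) \<partial>count_space UNIV) =
      (\<integral>\<^sup>+k. \<integral>\<^sup>+x. indicator ({x. k \<in> arrivals i \<tau> x} \<inter> B) x \<partial>two_sided_law p m j \<partial>count_space UNIV)"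
    by (intro nn_integral_cong) (simp only: nn_integral_indicator[OF A])
  also have "\<dots> = (\<integral>\<^sup>+x. \<integral>\<^sup>+k. indicator ({x. k \<in> arrivals i \<tau> x} \<inter> B) x \<partial>count_space UNIV \<partial>two_sided_law p m j)"
    by (intro nn_integral_count_space_nn_integral[symmetric] borel_measurable_indicator A) simp
  also have "\<dots> = (\<integral>\<^sup>+x. emeasure (count_space UNIV) (arrivals i \<tau> x) * indicator B x \<partial>two_sided_law p m j)"
  proof (rule nn_integral_cong)
    fix x
    have "(\<integral>\<^sup>+k. indicator ({x. k \<in> arrivals i \<tau> x} \<inter> B) x \<partial>count_space UNIV) =
      (\<integral>\<^sup>+k. indicator (arrivals i \<tau> x) k * indicator B x \<partial>count_space UNIV)"
      by (intro nn_integral_cong) (auto split: split_indicator)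
    then show "(\<integral>\<^sup>+k. indicator ({x. k \<in> arrivals i \<tau> x} \<inter> B) x \<partial>count_space UNIV) =
        emeasure (count_space UNIV) (arrivals i \<tau> x) * indicator B x"
      by (simp add: nn_integral_multc)
  qed
  finally show ?thesis .
qed

section \<open>The law of the shifted process and necessity of integrality\<close>

lemma two_sided_start_AE:
  assumes "two_sided_markov_chain M X p m (return_pmf i)"
  shows "AE \<omega> in M. X 0 \<omega> = i"
proof -
  interpret prob_space M using assms by (simp add: two_sided_markov_chain_def)
  have [measurable]: "X 0 \<in> measurable M (count_space UNIV)" using assms by (simp add: two_sided_markov_chain_def)
  have eq: "distr M (count_space UNIV) (X 0) = measure_pmf (return_pmf i)"
    using assms by (simp add: two_sided_markov_chain_def)
  have "AE s in distr M (count_space UNIV) (X 0). s = i"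
    unfolding eq by (simp add: AE_measure_pmf_iff)
  then show ?thesis by (subst (asm) AE_distr_iff) auto
qed

lemma two_sided_start_law:
  assumes p: "transition_matrix p" and m: "stationary_measure p m"
    and X: "two_sided_markov_chain M X p m (return_pmf i)" and B: "B \<in> sets paths"
  shows "emeasure M {\<omega>\<in>space M. (\<lambda>n. X n \<omega>) \<in> B} = emeasure (two_sided_law p m i) B"
proof -
  have meas: "\<And>n. X n \<in> measurable M (count_space UNIV)" using X by (simp add: two_sided_markov_chain_def)
  have "(\<lambda>\<omega> n. X n \<omega>) -` B \<inter> space M \<in> sets M"
    using measurable_sets[OF measurable_paths[of X M, OF meas] B] .
  then have 1: "{\<omega>\<in>space M. (\<lambda>n. X n \<omega>) \<in> B} \<in> sets M"
    by (simp add: vimage_def Int_def conj_commute)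
  have "X 0 -` {i} \<inter> space M \<in> sets M" by (rule measurable_sets[OF meas]) simp
  then have 2: "{\<omega>\<in>space M. X 0 \<omega> = i} \<in> sets M"
    by (simp add: vimage_def Int_def conj_commute)
  have "emeasure M {\<omega>\<in>space M. (\<lambda>n. X n \<omega>) \<in> B} = emeasure M {\<omega>\<in>space M. X 0 \<omega> = i \<and> (\<lambda>n. X n \<omega>) \<in> B}"
    using two_sided_start_AE[OF X] sets.Int[OF 1 2] 1
    by (intro emeasure_eq_AE) (auto simp: Int_def conj_ac)
  then show ?thesis using two_sided_markov_chain_law[OF p m X B, of i] by simp
qed

lemma shifted_process_law:
  assumes p: "transition_matrix p" and m: "stationary_measure p m"
    and X: "two_sided_markov_chain M X p m (return_pmf i)"
    and \<tau>: "\<tau> \<in> measurable paths (count_space UNIV)" and T: "\<And>\<omega>. \<omega> \<in> space M \<Longrightarrow> T \<omega> = \<tau> (\<lambda>n. X n \<omega>)"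
    and fin: "AE \<omega> in M. T \<omega> \<noteq> None" and B: "B \<in> sets paths"
    and Y: "\<And>n. shifted_process X T n \<in> measurable M (count_space UNIV)"
  shows "emeasure M {\<omega>\<in>space M. shifted_process X T 0 \<omega> = j \<and> (\<lambda>n. shifted_process X T n \<omega>) \<in> B} =
    emeasure (two_sided_law p m i) {x. \<exists>k. \<tau> x = Some k \<and> x k = j \<and> shift_path k x \<in> B}"
proof -
  let ?E = "{x. \<exists>k. \<tau> x = Some k \<and> x k = j \<and> shift_path k x \<in> B}"
  have meas: "\<And>n. X n \<in> measurable M (count_space UNIV)" using X by (simp add: two_sided_markov_chain_def)
  have "?E = (\<Union>k. {x. \<tau> x = Some k \<and> x k = j \<and> shift_path k x \<in> B})" by auto
  moreover have "(\<Union>k. {x. \<tau> x = Some k \<and> x k = j \<and> shift_path k x \<in> B}) \<in> sets paths"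
    using sets_shifted_event[OF \<tau> B] by (intro sets.countable_UN) auto
  ultimately have E: "?E \<in> sets paths" by simp
  have "(\<lambda>\<omega> n. X n \<omega>) -` ?E \<inter> space M \<in> sets M"
    using measurable_sets[OF measurable_paths[of X M, OF meas] E] .
  then have 1: "{\<omega>\<in>space M. (\<lambda>n. X n \<omega>) \<in> ?E} \<in> sets M"
    by (simp add: vimage_def Int_def conj_commute)
  have a: "(\<lambda>\<omega> n. shifted_process X T n \<omega>) -` B \<inter> space M \<in> sets M"
    using measurable_sets[OF measurable_paths[of "shifted_process X T" M, OF Y] B] .
  have b: "shifted_process X T 0 -` {j} \<inter> space M \<in> sets M"
    by (rule measurable_sets[OF Y]) simp
  from sets.Int[OF a b]
  have 2: "{\<omega>\<in>space M. shifted_process X T 0 \<omega> = j \<and> (\<lambda>n. shifted_process X T n \<omega>) \<in> B} \<in> sets M"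
    by (simp add: vimage_def Int_def conj_ac)
  have "emeasure M {\<omega>\<in>space M. shifted_process X T 0 \<omega> = j \<and> (\<lambda>n. shifted_process X T n \<omega>) \<in> B} =
    emeasure M {\<omega>\<in>space M. (\<lambda>n. X n \<omega>) \<in> ?E}"
  proof (rule emeasure_eq_AE[OF _ 2 1])
    show "AE \<omega> in M. (\<omega> \<in> {\<omega>\<in>space M. shifted_process X T 0 \<omega> = j \<and> (\<lambda>n. shifted_process X T n \<omega>) \<in> B}) \<longleftrightarrow>
      (\<omega> \<in> {\<omega>\<in>space M. (\<lambda>n. X n \<omega>) \<in> ?E})"
      using fin AE_space
    proof eventually_elim
      case (elim \<omega>)
      then obtain k where T': "T \<omega> = Some k" by blast
      then have k: "\<tau> (\<lambda>n. X n \<omega>) = Some k" using T[OF elim(2)] by simp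
      have "shift_path k (\<lambda>n. X n \<omega>) = (\<lambda>n. X (n + k) \<omega>)" by (auto simp: shift_path_def)
      then show ?case using elim(2) k by (simp add: shifted_process_def T')
    qed
  qed
  from this two_sided_start_law[OF p m X E] show ?thesis by (rule trans)
qed

lemma shift_mass_integer:
  assumes p: "transition_matrix p" and m: "stationary_measure p m"
    and X: "two_sided_markov_chain M X p m (return_pmf i)"
    and T: "nonrandomized_time M X T"
    and Y: "two_sided_markov_chain M (shifted_process X T) p m \<nu>"
  shows "m i / m j * pmf \<nu> j \<in> \<int>"
proof -
  obtain \<tau> where \<tau>: "\<tau> \<in> measurable paths (count_space UNIV)" and T': "\<And>\<omega>. \<omega> \<in> space M \<Longrightarrow> T \<omega> = \<tau> (\<lambda>n. X n \<omega>)"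
    and fin: "AE \<omega> in M. T \<omega> \<noteq> None"
    using T unfolding nonrandomized_time_def random_time_def by blast
  have Y': "\<And>n. shifted_process X T n \<in> measurable M (count_space UNIV)"
    using Y unfolding two_sided_markov_chain_def by blast
  have pos: "0 < m k" for k using m by (simp add: stationary_measure_def)
  define c where "c = m i / m j * pmf \<nu> j"
  have c: "0 \<le> c" using less_imp_le[OF pos] by (simp add: c_def)
  let ?J = "two_sided_law p m j"
  interpret J: prob_space ?J by (rule prob_space_two_sided_law)
  let ?N = "\<lambda>x. emeasure (count_space UNIV) (arrivals i \<tau> x)"
  have N: "?N \<in> borel_measurable ?J"
    using measurable_card_arrivals[OF \<tau>, of i] unfolding measurable_cong_sets[OF sets_two_sided_law refl] .
  have "density ?J ?N = density ?J (\<lambda>_. ennreal c)"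
  proof (rule measure_eqI)
    fix B assume "B \<in> sets (density ?J ?N)"
    then have B: "B \<in> sets paths" by simp
    have "ennreal (m i) * (ennreal (pmf \<nu> j) * emeasure ?J B) = ennreal (m j) * (\<integral>\<^sup>+x. ?N x * indicator B x \<partial>?J)"
    proof -
      have "ennreal (pmf \<nu> j) * emeasure ?J B =
          emeasure (two_sided_law p m i) {x. \<exists>k. \<tau> x = Some k \<and> x k = j \<and> shift_path k x \<in> B}"
        using two_sided_markov_chain_law[OF p m Y B, of j, symmetric]
          shifted_process_law[OF p m X \<tau> T' fin B Y', of j] by (rule trans)
      from arg_cong[OF this, of "\<lambda>z. ennreal (m i) * z"] mass_transport[OF p m \<tau> B, of i j]
      show ?thesis by (rule trans)
    qed
    moreover have "ennreal (m i) * (ennreal (pmf \<nu> j) * emeasure ?J B) = ennreal (m j) * (ennreal c * emeasure ?J B)"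
    proof -
      have "m i * pmf \<nu> j = m j * c" using pos[of j] by (simp add: c_def)
      then have "ennreal (m i) * ennreal (pmf \<nu> j) = ennreal (m j) * ennreal c"
        using less_imp_le[OF pos] c by (simp add: ennreal_mult[symmetric])
      then show ?thesis by (simp add: mult.assoc[symmetric])
    qed
    ultimately have "ennreal (m j) * (\<integral>\<^sup>+x. ?N x * indicator B x \<partial>?J) = ennreal (m j) * (ennreal c * emeasure ?J B)"
      by simp
    then have "(\<integral>\<^sup>+x. ?N x * indicator B x \<partial>?J) = ennreal c * emeasure ?J B"
      using pos[of j] by (simp add: ennreal_mult_cancel_left)
    then show "emeasure (density ?J ?N) B = emeasure (density ?J (\<lambda>_. ennreal c)) B"
      using N B by (simp add: emeasure_density nn_integral_cmult_indicator)
  qed simp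
  \<comment> \<open>Equality of the two densities on every event is what makes the number of
    arrivals almost surely constant, and not merely of mean \<open>c\<close>.\<close>
  then have "AE x in ?J. ?N x = ennreal c"
    by (intro J.density_unique N) auto
  \<comment> \<open>An almost sure event of a probability space is nonempty, and a single path
    decides whether \<open>c\<close> is an integer.\<close>
  then have "\<exists>x. ?N x = ennreal c"
    by (rule contrapos_pp) simp
  then obtain x where x: "?N x = ennreal c" ..
  \<comment> \<open>Counting measure is infinite on infinite sets, so a finite value makes the
    arrivals a finite set.\<close>
  then have "finite (arrivals i \<tau> x)" by (auto simp: emeasure_count_space split: if_splits)
  then have "ennreal (real (card (arrivals i \<tau> x))) = ennreal c"
    using x by (simp add: emeasure_count_space_finite ennreal_of_nat_eq_real_of_nat)
  then have "real (card (arrivals i \<tau> x)) = c" using c by simp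
  then show ?thesis unfolding c_def[symmetric] by (metis Ints_of_nat)
qed

subsection \<open>Excursions of a recurrent chain\<close>

lemma measurable_case_nat_path: "case_nat j \<in> measurable paths paths"
proof -
  have "(\<lambda>y. case_nat j y n) \<in> measurable paths (count_space UNIV)" for n
    by (cases n) simp_all
  from measurable_paths[of "\<lambda>n y. case_nat j y n", OF this] show ?thesis by simp
qed

lemma sets_avoiding_paths:
  "{x. \<forall>k\<in>{1..n}. x k \<noteq> i} \<in> sets (paths :: (nat \<Rightarrow> 's::countable) measure)"
proof -
  have "{x. \<forall>k\<in>{1..n}. x k \<noteq> i} = UNIV - (\<Union>k\<in>{1..n}. {x :: nat \<Rightarrow> 's. x k = i})" by auto
  also have "\<dots> \<in> sets paths"
    using sets.compl_sets[OF sets.finite_UN[of "{1..n}" "\<lambda>k. {x. x k = i}" "paths :: (nat \<Rightarrow> 's) measure"]]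
      sets_path_coordinate by simp
  finally show ?thesis .
qed

text \<open>The Markov property at time 1 for arbitrary path events. Choosing \<open>k\<close> from
  the row of \<open>j\<close>, running the chain from \<open>k\<close> and prefixing
  \<open>j\<close> produces a law with the cylinder probabilities of the chain from
  \<open>j\<close>, and these determine it.\<close>

lemma emeasure_chain_law_first_step:
  fixes q :: "'s::countable \<Rightarrow> 's \<Rightarrow> real"
  assumes q: "transition_matrix q" and B: "B \<in> sets paths"
  shows "emeasure (chain_law q j) B =
    (\<integral>\<^sup>+k. emeasure (chain_law q k) {y. case_nat j y \<in> B} \<partial>row_pmf q j)"
proof -
  define f where "f k = distr (chain_law q k) paths (case_nat j)" for k
  have cn': "case_nat j \<in> measurable (chain_law q k) paths" for k
    using measurable_case_nat_path unfolding measurable_cong_sets[OF sets_chain_law refl] .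
  have f: "prob_space (f k)" for k
    unfolding f_def by (rule prob_space.prob_space_distr[OF prob_space_chain_law cn'])
  have fm: "f \<in> measurable (measure_pmf (row_pmf q j)) (subprob_algebra paths)"
    using f by (auto simp: measurable_pmf_measure1 space_subprob_algebra f_def prob_space_imp_subprob_space)
  define N where "N = measure_pmf (row_pmf q j) \<bind> f"
  have ef: "emeasure (f k) S = emeasure (chain_law q k) {y. case_nat j y \<in> S}" if "S \<in> sets paths" for k S
    unfolding f_def using that cn' by (subst emeasure_distr) (auto simp: vimage_def)
  have eN: "emeasure N S = (\<integral>\<^sup>+k. emeasure (chain_law q k) {y. case_nat j y \<in> S} \<partial>row_pmf q j)"
    if "S \<in> sets paths" for S
    unfolding N_def using that by (subst emeasure_bind[OF _ fm]) (simp_all add: ef)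
  have "N = chain_law q j"
  proof (rule chain_law_eqI[OF q])
    show "sets N = sets paths" unfolding N_def by (subst sets_bind[where N = paths]) (simp_all add: f_def)
    show "prob_space N" unfolding N_def using fm f
      by (intro measure_pmf.prob_space_bind[where S = paths]) auto
    fix n :: nat and y :: "nat \<Rightarrow> 's"
    let ?S = "{x. \<forall>k\<le>n. x k = y k}"
    have S: "?S \<in> sets paths" using sets_path_event[of "{..n}" y] by (simp add: Ball_def)
    show "emeasure N ?S = ennreal (of_bool (y 0 = j) * (\<Prod>k<n. q (y k) (y (Suc k))))"
    proof (cases n)
      case 0
      have "{z. case_nat j z \<in> ?S} = (if y 0 = j then UNIV else {})" by (auto simp: 0)
      moreover have "emeasure (chain_law q k) UNIV = 1" for k
        using prob_space.emeasure_space_1[OF prob_space_chain_law[of q k]] by simp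
      ultimately show ?thesis unfolding eN[OF S] by (simp add: 0 measure_pmf.emeasure_space_1[simplified])
    next
      case (Suc n')
      have *: "{z. case_nat j z \<in> ?S} = (if y 0 = j then {z. \<forall>k\<le>n'. z k = y (Suc k)} else {})"
      proof -
        have "(\<forall>k\<le>Suc n'. case_nat j z k = y k) \<longleftrightarrow> j = y 0 \<and> (\<forall>k\<le>n'. z k = y (Suc k))" for z
        proof
          assume a: "\<forall>k\<le>Suc n'. case_nat j z k = y k"
          have "z k = y (Suc k)" if "k \<le> n'" for k using a[rule_format, of "Suc k"] that by simp
          then show "j = y 0 \<and> (\<forall>k\<le>n'. z k = y (Suc k))" using a[rule_format, of 0] by simp
        next
          assume a: "j = y 0 \<and> (\<forall>k\<le>n'. z k = y (Suc k))"
          show "\<forall>k\<le>Suc n'. case_nat j z k = y k"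
          proof (intro allI impI)
            fix k assume "k \<le> Suc n'"
            then show "case_nat j z k = y k" using a by (cases k) auto
          qed
        qed
        then show ?thesis by (auto simp: Suc)
      qed
      let ?c = "of_bool (y 0 = j) * (\<Prod>k<n'. q (y (Suc k)) (y (Suc (Suc k))))"
      have c: "0 \<le> ?c" using q by (intro mult_nonneg_nonneg prod_nonneg) (auto simp: transition_matrix_def)
      have "emeasure (chain_law q k) {z. case_nat j z \<in> ?S} = ennreal ?c * indicator {y (Suc 0)} k" for k
        unfolding * using emeasure_chain_law_cylinder[OF q, of k n' "\<lambda>k. y (Suc k)"]
        by (auto split: split_indicator)
      then have "emeasure N ?S = ennreal ?c * emeasure (row_pmf q j) {y (Suc 0)}"
        unfolding eN[OF S] by (simp add: nn_integral_cmult_indicator)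
      also have "\<dots> = ennreal (?c * q j (y (Suc 0)))"
        using c q by (simp add: emeasure_pmf_single pmf_row_pmf[OF q] ennreal_mult transition_matrix_def)
      also have "?c * q j (y (Suc 0)) = of_bool (y 0 = j) * (\<Prod>k<n. q (y k) (y (Suc k)))"
        unfolding Suc prod.lessThan_Suc_shift by (cases "y 0 = j") simp_all
      finally show ?thesis .
    qed
  qed
  then show ?thesis using eN[OF B] by simp
qed

text \<open>\<open>(taboo p i ^^ n) f j\<close> is the expectation of \<open>f (x n)\<close> on the event that \<open>x 1, \<dots>, x n\<close> avoid \<open>i\<close>.\<close>
definition taboo :: "('s::countable \<Rightarrow> 's \<Rightarrow> real) \<Rightarrow> 's \<Rightarrow> ('s \<Rightarrow> ennreal) \<Rightarrow> 's \<Rightarrow> ennreal" where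
  "taboo p i f j = (\<integral>\<^sup>+k. f k * indicator (- {i}) k \<partial>row_pmf p j)"

lemma taboo_add: "taboo p i (\<lambda>k. f k + g k) = (\<lambda>j. taboo p i f j + taboo p i g j)"
  by (auto simp: taboo_def fun_eq_iff distrib_right nn_integral_add)

lemma taboo_cmult: "taboo p i (\<lambda>k. c * f k) = (\<lambda>j. c * taboo p i f j)"
  by (auto simp: taboo_def fun_eq_iff mult.assoc nn_integral_cmult)

lemma taboo_mono: "(\<And>k. f k \<le> g k) \<Longrightarrow> taboo p i f j \<le> taboo p i g j"
  unfolding taboo_def by (intro nn_integral_mono mult_right_mono) auto

lemma taboo_pow_add: "(taboo p i ^^ n) (\<lambda>k. f k + g k) = (\<lambda>j. (taboo p i ^^ n) f j + (taboo p i ^^ n) g j)"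
  by (induction n) (simp_all add: taboo_add)

lemma taboo_pow_cmult: "(taboo p i ^^ n) (\<lambda>k. c * f k) = (\<lambda>j. c * (taboo p i ^^ n) f j)"
  by (induction n) (simp_all add: taboo_cmult)

lemma taboo_pow_mono: "(\<And>k. f k \<le> g k) \<Longrightarrow> (taboo p i ^^ n) f j \<le> (taboo p i ^^ n) g j"
  by (induction n arbitrary: j) (simp_all add: taboo_mono)

lemma taboo_pow_const: "(taboo p i ^^ n) (\<lambda>k. c) = (\<lambda>j. c * (taboo p i ^^ n) (\<lambda>k. 1) j)"
  using taboo_pow_cmult[of n p i c "\<lambda>k. 1"] by simp

lemma taboo_pow_eq_sum:
  fixes p :: "'s::countable \<Rightarrow> 's \<Rightarrow> real"
  shows "(taboo p i ^^ n) f j = (\<integral>\<^sup>+k. f k * (taboo p i ^^ n) (indicator {k}) j \<partial>count_space UNIV)"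
proof (induction n arbitrary: j)
  case 0
  have "(\<integral>\<^sup>+k. f k * indicator {k} j \<partial>count_space UNIV) = (\<integral>\<^sup>+k. f j * indicator {j} k \<partial>count_space UNIV)"
    by (intro nn_integral_cong) (auto split: split_indicator)
  then show ?case by simp
next
  case (Suc n)
  have "(taboo p i ^^ Suc n) f j =
    (\<integral>\<^sup>+l. (\<integral>\<^sup>+k. f k * (taboo p i ^^ n) (indicator {k}) l \<partial>count_space UNIV) * indicator (- {i}) l \<partial>row_pmf p j)"
    unfolding funpow.simps o_apply taboo_def[of p i "(taboo p i ^^ n) f"] Suc ..
  also have "\<dots> = (\<integral>\<^sup>+l. \<integral>\<^sup>+k. f k * (taboo p i ^^ n) (indicator {k}) l * indicator (- {i}) l \<partial>count_space UNIV \<partial>row_pmf p j)"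
    by (intro nn_integral_cong nn_integral_multc[symmetric]) simp
  also have "\<dots> = (\<integral>\<^sup>+k. \<integral>\<^sup>+l. f k * (taboo p i ^^ n) (indicator {k}) l * indicator (- {i}) l \<partial>row_pmf p j \<partial>count_space UNIV)"
    by (intro nn_integral_count_space_nn_integral) auto
  also have "\<dots> = (\<integral>\<^sup>+k. f k * (taboo p i ^^ Suc n) (indicator {k}) j \<partial>count_space UNIV)"
    by (intro nn_integral_cong) (simp add: taboo_def mult.assoc nn_integral_cmult)
  finally show ?case .
qed

lemma taboo_pow_one:
  fixes p :: "'s::countable \<Rightarrow> 's \<Rightarrow> real"
  assumes p: "transition_matrix p"
  shows "(taboo p i ^^ n) (\<lambda>k. 1) j = emeasure (chain_law p j) {x. \<forall>k\<in>{1..n}. x k \<noteq> i}"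
proof (induction n arbitrary: j)
  case 0
  then show ?case using prob_space.emeasure_space_1[OF prob_space_chain_law[of p j]] by simp
next
  case (Suc n)
  note S = sets_avoiding_paths[where i = i]
  have "emeasure (chain_law p j) {x. \<forall>k\<in>{1..Suc n}. x k \<noteq> i} =
    (\<integral>\<^sup>+k. emeasure (chain_law p k) {y. case_nat j y \<in> {x. \<forall>k\<in>{1..Suc n}. x k \<noteq> i}} \<partial>row_pmf p j)"
    by (rule emeasure_chain_law_first_step[OF p S])
  also have "\<dots> = (\<integral>\<^sup>+k. emeasure (chain_law p k) {x. \<forall>k\<in>{1..n}. x k \<noteq> i} * indicator (- {i}) k \<partial>row_pmf p j)"
  proof (rule nn_integral_cong)
    fix k
    have 1: "{y. case_nat j y \<in> {x. \<forall>k\<in>{1..Suc n}. x k \<noteq> i}} = {y. y 0 \<noteq> i} \<inter> {y. \<forall>k\<in>{1..n}. y k \<noteq> i}"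
    proof -
      have "(\<forall>k\<in>{1..Suc n}. case_nat j y k \<noteq> i) \<longleftrightarrow> y 0 \<noteq> i \<and> (\<forall>k\<in>{1..n}. y k \<noteq> i)" for y
      proof -
        have "case_nat j y k \<noteq> i" if "y 0 \<noteq> i" "\<forall>k\<in>{1..n}. y k \<noteq> i" "k \<in> {1..Suc n}" for k
        proof (cases k)
          case (Suc k')
          then show ?thesis using that by (cases k') auto
        qed (use that in simp)
        moreover have "y 0 \<noteq> i" "y k \<noteq> i" if "\<forall>k\<in>{1..Suc n}. case_nat j y k \<noteq> i" "k \<in> {1..n}" for k
          using that(1)[rule_format, of 1] that(1)[rule_format, of "Suc k"] that(2) by auto
        moreover have "y 0 \<noteq> i" if "\<forall>k\<in>{1..Suc n}. case_nat j y k \<noteq> i"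
          using that[rule_format, of 1] by auto
        ultimately show ?thesis by blast
      qed
      then show ?thesis by auto
    qed
    \<comment> \<open>The chain from \<open>k\<close> has \<open>y 0 = k\<close> almost surely, so
      the condition on \<open>y 0\<close> becomes the indicator in the definition of
      \<open>taboo\<close>.\<close>
    have "emeasure (chain_law p k) ({y. y 0 \<noteq> i} \<inter> {y. \<forall>k\<in>{1..n}. y k \<noteq> i}) =
      emeasure (chain_law p k) (if k = i then {} else {y. \<forall>k\<in>{1..n}. y k \<noteq> i})"
    proof (rule emeasure_eq_AE)
      show "AE x in chain_law p k. (x \<in> {y. y 0 \<noteq> i} \<inter> {y. \<forall>k\<in>{1..n}. y k \<noteq> i}) =
          (x \<in> (if k = i then {} else {y. \<forall>k\<in>{1..n}. y k \<noteq> i}))"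
        using AE_chain_law_start[OF p, of k] by eventually_elim auto
      have "{y. y 0 \<noteq> i} = UNIV - {y. y (0::nat) = i}" by auto
      also have "\<dots> \<in> sets paths" using sets.compl_sets[OF sets_path_coordinate[of 0 i]] by simp
      finally have "{y. y (0::nat) \<noteq> i} \<in> sets paths" .
      then show "{y. y 0 \<noteq> i} \<inter> {y. \<forall>k\<in>{1..n}. y k \<noteq> i} \<in> sets (chain_law p k)"
        using S[of n] by simp
      show "(if k = i then {} else {y. \<forall>k\<in>{1..n}. y k \<noteq> i}) \<in> sets (chain_law p k)"
        using S[of n] by simp
    qed
    then show "emeasure (chain_law p k) {y. case_nat j y \<in> {x. \<forall>k\<in>{1..Suc n}. x k \<noteq> i}} =
        emeasure (chain_law p k) {x. \<forall>k\<in>{1..n}. x k \<noteq> i} * indicator (- {i}) k"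
      unfolding 1 by (auto split: split_indicator)
  qed
  also have "\<dots> = (taboo p i ^^ Suc n) (\<lambda>k. 1) j"
    unfolding funpow.simps o_apply taboo_def[of p i "(taboo p i ^^ n) (\<lambda>k. 1)"] Suc ..
  finally show ?case ..
qed

section \<open>Return times, occupation of an excursion and bounded harmonic functions\<close>

locale recurrent_chain =
  fixes p :: "'s::countable \<Rightarrow> 's \<Rightarrow> real" and m :: "'s \<Rightarrow> real"
  assumes p: "transition_matrix p" and irreducible: "irreducible_matrix p"
    and recurrent: "recurrent_matrix p" and m: "stationary_measure p m"
begin

lemma m_pos: "0 < m j" using m by (simp add: stationary_measure_def)

lemma p_nonneg: "0 \<le> p j k" using p by (simp add: transition_matrix_def)

lemma AE_chain_law_return: "AE x in chain_law p i. \<exists>n>0. x n = i"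
proof -
  obtain N :: "(nat \<Rightarrow> 's) measure" where N: "markov_chain N (\<lambda>n x. x n) p" "AE x in N. x 0 = i" "AE x in N. \<exists>n>0. x n = i"
    using recurrent unfolding recurrent_matrix_def by blast
  have d: "distr N paths (\<lambda>x n. x n) = chain_law p i" by (rule markov_chain_distr[OF N(1) p N(2)])
  have mN: "(\<lambda>x n. x n) \<in> measurable N paths"
    using N(1) by (intro measurable_paths) (simp add: markov_chain_def)
  have "{x. \<exists>n>0. x n = i} = (\<Union>n\<in>{0<..}. {x :: nat \<Rightarrow> 's. x n = i})" by auto
  also have "\<dots> \<in> sets paths" by (intro sets.countable_UN'') (auto intro: sets_path_coordinate)
  finally have S: "{x :: nat \<Rightarrow> 's. \<exists>n>0. x n = i} \<in> sets paths" .
  have "AE x in distr N paths (\<lambda>x n. x n). \<exists>n>0. x n = i"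
    using N(3) by (subst AE_distr_iff[OF mN]) (use S in simp_all)
  then show ?thesis unfolding d .
qed

lemma taboo_pow_one_tendsto_0: "(\<lambda>n. (taboo p i ^^ n) (\<lambda>k. 1) i) \<longlonglongrightarrow> 0"
proof -
  let ?A = "\<lambda>n. {x :: nat \<Rightarrow> 's. \<forall>k\<in>{1..n}. x k \<noteq> i}"
  interpret prob_space "chain_law p i" by (rule prob_space_chain_law)
  note S = sets_avoiding_paths[where i = i]
  have "(\<lambda>n. emeasure (chain_law p i) (?A n)) \<longlonglongrightarrow> emeasure (chain_law p i) (\<Inter>n. ?A n)"
    using S by (intro Lim_emeasure_decseq) (auto simp: decseq_def)
  moreover have "emeasure (chain_law p i) (\<Inter>n. ?A n) = 0"
  proof -
    have "AE x in chain_law p i. x \<notin> (\<Inter>n. ?A n)"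
      using AE_chain_law_return[of i]
    proof eventually_elim
      case (elim x)
      then obtain n where "n > 0" "x n = i" by blast
      then have "x \<notin> ?A n" by auto
      then show ?case by blast
    qed
    moreover have "(\<Inter>n. ?A n) \<in> sets (chain_law p i)"
      using S by (intro sets.countable_INT') auto
    ultimately have "(\<Inter>n. ?A n) \<in> null_sets (chain_law p i)" using AE_iff_null_sets by blast
    then show ?thesis by (rule null_setsD1)
  qed
  ultimately show ?thesis unfolding taboo_pow_one[OF p] by simp
qed

lemma expectation_eq_taboo:
  "(\<integral>\<^sup>+k. f k \<partial>row_pmf p j) = taboo p i f j + ennreal (p j i) * f i"
proof -
  have "(\<integral>\<^sup>+k. f k \<partial>row_pmf p j) = (\<integral>\<^sup>+k. f k * indicator (- {i}) k + f i * indicator {i} k \<partial>row_pmf p j)"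
    by (intro nn_integral_cong) (auto split: split_indicator)
  also have "\<dots> = taboo p i f j + f i * emeasure (row_pmf p j) {i}"
    unfolding taboo_def by (subst nn_integral_add) (simp_all add: nn_integral_cmult_indicator)
  finally show ?thesis by (simp add: emeasure_pmf_single pmf_row_pmf[OF p] mult.commute)
qed

lemma taboo_one: "taboo p i (\<lambda>k. 1) j + ennreal (p j i) = 1"
  using expectation_eq_taboo[where f = "\<lambda>k. 1"] by (simp add: measure_pmf.emeasure_space_1[simplified])

lemma taboo_pow_one_le: "(taboo p i ^^ n) (\<lambda>k. 1) j \<le> 1"
  unfolding taboo_pow_one[OF p] by (intro prob_space.emeasure_le_1 prob_space_chain_law)

text \<open>Dynkin's formula for the chain stopped at its first return to \<open>i\<close>.\<close>
lemma taboo_dynkin: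
  assumes g: "\<And>j. g j = (\<integral>\<^sup>+k. f k \<partial>row_pmf p j)"
  shows "(\<Sum>t<n. (taboo p i ^^ t) g x) + f i * (taboo p i ^^ n) (\<lambda>k. 1) x + f x =
    (\<Sum>t<n. (taboo p i ^^ t) f x) + (taboo p i ^^ n) f x + f i"
proof (induction n)
  case (Suc n)
  let ?R = "taboo p i"
  \<comment> \<open>One step of the stopped chain: the missing mass
    \<open>1 - ?R (\<lambda>k. 1) j\<close> has arrived at \<open>i\<close> and contributes
    \<open>f i\<close>. Moving the negative terms to the other side keeps the identity meaningful in
    \<open>ennreal\<close>, here and in the telescoped sum.\<close>
  have "g j + f i * ?R (\<lambda>k. 1) j = ?R f j + f i" for j
  proof -
    have "g j + f i * ?R (\<lambda>k. 1) j = ?R f j + f i * (?R (\<lambda>k. 1) j + ennreal (p j i))"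
      unfolding g expectation_eq_taboo[where f = f and j = j and i = i] by (simp add: distrib_left mult.commute add_ac)
    then show ?thesis by (simp add: taboo_one)
  qed
  then have "(?R ^^ n) (\<lambda>j. g j + f i * ?R (\<lambda>k. 1) j) x = (?R ^^ n) (\<lambda>j. ?R f j + f i) x" by simp
  then have step: "(?R ^^ n) g x + f i * (?R ^^ Suc n) (\<lambda>k. 1) x = (?R ^^ Suc n) f x + f i * (?R ^^ n) (\<lambda>k. 1) x"
    unfolding taboo_pow_add taboo_pow_cmult funpow_Suc_right o_apply
    by (simp add: taboo_pow_const[of n p i "f i"])
  have "(\<Sum>t<Suc n. (?R ^^ t) g x) + f i * (?R ^^ Suc n) (\<lambda>k. 1) x + f x =
    (\<Sum>t<n. (?R ^^ t) g x) + ((?R ^^ n) g x + f i * (?R ^^ Suc n) (\<lambda>k. 1) x) + f x"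
    by (simp add: add_ac)
  also have "\<dots> = ((\<Sum>t<n. (?R ^^ t) g x) + f i * (?R ^^ n) (\<lambda>k. 1) x + f x) + (?R ^^ Suc n) f x"
    unfolding step by (simp add: add_ac)
  also have "\<dots> = (\<Sum>t<Suc n. (?R ^^ t) f x) + (?R ^^ Suc n) f x + f i"
    unfolding Suc by (simp add: add_ac)
  finally show ?case .
qed (simp add: add_ac)

text \<open>Expected number of visits to \<open>k\<close> during an excursion from \<open>i\<close>;
  time 0 is counted and the return to \<open>i\<close> is not.\<close>

definition occupation :: "'s \<Rightarrow> 's \<Rightarrow> ennreal" where
  "occupation i k = (\<Sum>t. (taboo p i ^^ t) (indicator {k}) i)"

lemma nn_integral_stationary:
  "(\<integral>\<^sup>+j. ennreal (m j / c) * ennreal (p j k) \<partial>count_space UNIV) = ennreal (m k / c)" if "0 < c"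
proof -
  have "((\<lambda>j. m j * p j k) has_sum m k) UNIV" using m by (simp add: stationary_measure_def)
  from has_sum_cmult_right[OF this, of "1 / c"]
  have "((\<lambda>j. m j / c * p j k) has_sum (m k / c)) UNIV" by simp
  from nn_integral_count_space_has_sum[OF _ this]
  have "(\<integral>\<^sup>+j. ennreal (m j / c * p j k) \<partial>count_space UNIV) = ennreal (m k / c)"
    using that less_imp_le[OF m_pos] p_nonneg by simp
  moreover have "ennreal (m j / c * p j k) = ennreal (m j / c) * ennreal (p j k)" for j
    using that less_imp_le[OF m_pos] p_nonneg by (intro ennreal_mult) simp_all
  ultimately show ?thesis by simp
qed

lemma taboo_indicator: "taboo p i (indicator {k}) j = indicator (- {i}) k * ennreal (p j k)"
proof -
  have "taboo p i (indicator {k}) j = (\<integral>\<^sup>+l. indicator (- {i}) k * indicator {k} l \<partial>row_pmf p j)"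
    unfolding taboo_def by (intro nn_integral_cong) (auto split: split_indicator)
  then show ?thesis by (simp add: nn_integral_cmult_indicator emeasure_pmf_single pmf_row_pmf[OF p])
qed

text \<open>Powers of \<open>taboo\<close> unfold at the first step, whereas stationarity concerns
  the last one. Here the last step is split off, and the indicator discards paths ending in
  \<open>i\<close>.\<close>

lemma taboo_indicator_Suc:
  "(taboo p i ^^ Suc t) (indicator {k}) i =
    indicator (- {i}) k * (\<integral>\<^sup>+j. (taboo p i ^^ t) (indicator {j}) i * ennreal (p j k) \<partial>count_space UNIV)"
proof -
  have "(taboo p i ^^ Suc t) (indicator {k}) i = (taboo p i ^^ t) (taboo p i (indicator {k})) i"
    by (simp add: funpow_Suc_right del: funpow.simps)
  also have "\<dots> = (\<integral>\<^sup>+j. taboo p i (indicator {k}) j * (taboo p i ^^ t) (indicator {j}) i \<partial>count_space UNIV)"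
    by (rule taboo_pow_eq_sum)
  also have "\<dots> = (\<integral>\<^sup>+j. indicator (- {i}) k * ((taboo p i ^^ t) (indicator {j}) i * ennreal (p j k)) \<partial>count_space UNIV)"
    by (intro nn_integral_cong) (simp add: taboo_indicator mult_ac)
  finally show ?thesis by (simp add: nn_integral_cmult)
qed

text \<open>The partial sums start from 0 and obey the recursion given by the last step. The bound
  \<open>m k / m i\<close> is preserved by it: off \<open>i\<close> by stationarity, and at
  \<open>i\<close> because it equals 1, the contribution of time 0. So induction on the number of
  terms applies.\<close>

lemma occupation_le: "occupation i k \<le> ennreal (m k / m i)"
  unfolding occupation_def suminf_eq_SUP
proof (rule SUP_least)
  fix n
  show "(\<Sum>t<n. (taboo p i ^^ t) (indicator {k}) i) \<le> ennreal (m k / m i)"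
  proof (induction n arbitrary: k)
    case (Suc n)
    have "(\<Sum>t<Suc n. (taboo p i ^^ t) (indicator {k}) i) =
      indicator {k} i + indicator (- {i}) k * (\<integral>\<^sup>+j. (\<Sum>t<n. (taboo p i ^^ t) (indicator {j}) i) * ennreal (p j k) \<partial>count_space UNIV)"
      unfolding sum.lessThan_Suc_shift taboo_indicator_Suc
      by (simp add: sum_distrib_left[symmetric] sum_distrib_right nn_integral_sum)
    also have "\<dots> \<le> indicator {k} i + indicator (- {i}) k * (\<integral>\<^sup>+j. ennreal (m j / m i) * ennreal (p j k) \<partial>count_space UNIV)"
      by (intro add_left_mono mult_left_mono nn_integral_mono mult_right_mono Suc) auto
    also have "\<dots> = indicator {k} i + indicator (- {i}) k * ennreal (m k / m i)"
      by (simp add: nn_integral_stationary m_pos)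
    also have "\<dots> \<le> ennreal (m k / m i)"
      using m_pos[of i] by (auto split: split_indicator)
    finally show ?case .
  qed simp
qed

text \<open>Off \<open>i\<close> this is the decomposition by the last step. At \<open>i\<close> the
  left side is the probability that the excursion ends, which is 1 by recurrence and agrees with the
  single visit counted at time 0.\<close>

lemma occupation_stationary:
  "(\<integral>\<^sup>+j. occupation i j * ennreal (p j k) \<partial>count_space UNIV) = occupation i k"
proof (cases "k = i")
  case False
  have "occupation i k = indicator {k} i + (\<Sum>t. (taboo p i ^^ Suc t) (indicator {k}) i)"
    unfolding occupation_def by (subst suminf_offset[where i = 1]) (simp_all add: add_ac)
  also have "\<dots> = (\<Sum>t. \<integral>\<^sup>+j. (taboo p i ^^ t) (indicator {j}) i * ennreal (p j k) \<partial>count_space UNIV)"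
    using False unfolding taboo_indicator_Suc by simp
  also have "\<dots> = (\<integral>\<^sup>+j. (\<Sum>t. (taboo p i ^^ t) (indicator {j}) i * ennreal (p j k)) \<partial>count_space UNIV)"
    by (intro nn_integral_suminf[symmetric]) simp
  finally show ?thesis unfolding occupation_def by simp
next
  case True
  let ?R = "taboo p i"
  have "(?R ^^ Suc t) (indicator {i}) i = 0" for t
    unfolding taboo_indicator_Suc by simp
  then have "occupation i i = 1"
    unfolding occupation_def by (subst suminf_offset[where i = 1]) (simp_all del: funpow.simps)
  moreover have "(\<integral>\<^sup>+j. occupation i j * ennreal (p j i) \<partial>count_space UNIV) = 1"
  proof -
    have "(\<integral>\<^sup>+j. occupation i j * ennreal (p j i) \<partial>count_space UNIV) =
      (\<integral>\<^sup>+j. (\<Sum>t. ennreal (p j i) * (?R ^^ t) (indicator {j}) i) \<partial>count_space UNIV)"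
      unfolding occupation_def by (simp add: mult.commute)
    also have "\<dots> = (\<Sum>t. \<integral>\<^sup>+j. ennreal (p j i) * (?R ^^ t) (indicator {j}) i \<partial>count_space UNIV)"
      by (intro nn_integral_suminf) simp
    also have "\<dots> = (\<Sum>t. (?R ^^ t) (\<lambda>j. ennreal (p j i)) i)"
      unfolding taboo_pow_eq_sum[of _ p i "\<lambda>j. ennreal (p j i)"] ..
    also have "\<dots> = 1"
    proof -
      \<comment> \<open>The term of index \<open>t\<close> is the probability that the first return
        happens at time \<open>t + 1\<close>; together with not having returned by time
        \<open>n\<close> these cases exhaust all paths.\<close>
      have eq: "(\<Sum>t<n. (?R ^^ t) (\<lambda>j. ennreal (p j i)) i) + (?R ^^ n) (\<lambda>k. 1) i = 1" for n
      proof (induction n)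
        case (Suc n)
        have "(?R ^^ n) (\<lambda>j. ?R (\<lambda>k. 1) j + ennreal (p j i)) i = (?R ^^ n) (\<lambda>k. 1) i"
          by (simp add: taboo_one)
        then have "(?R ^^ Suc n) (\<lambda>k. 1) i + (?R ^^ n) (\<lambda>j. ennreal (p j i)) i = (?R ^^ n) (\<lambda>k. 1) i"
          unfolding taboo_pow_add funpow_Suc_right by simp
        then have "(\<Sum>t<n. (?R ^^ t) (\<lambda>j. ennreal (p j i)) i) +
            ((?R ^^ Suc n) (\<lambda>k. 1) i + (?R ^^ n) (\<lambda>j. ennreal (p j i)) i) = 1"
          using Suc by simp
        then show ?case by (simp add: add_ac del: funpow.simps)
      qed simp
      have "(\<lambda>n. (\<Sum>t<n. (?R ^^ t) (\<lambda>j. ennreal (p j i)) i) + (?R ^^ n) (\<lambda>k. 1) i)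
          \<longlonglongrightarrow> (\<Sum>t. (?R ^^ t) (\<lambda>j. ennreal (p j i)) i) + 0"
        by (intro tendsto_add summable_LIMSEQ taboo_pow_one_tendsto_0) simp
      then show ?thesis unfolding eq by (simp add: LIMSEQ_const_iff)
    qed
    finally show ?thesis .
  qed
  ultimately show ?thesis using True by simp
qed

lemma matrix_power_nonneg: "0 \<le> matrix_power p n j k"
  by (induction n arbitrary: j) (auto intro!: infsum_nonneg mult_nonneg_nonneg p_nonneg)

text \<open>Both sides are stationary, one dominates the other, and they agree at \<open>i\<close>.
  If they agree at \<open>k\<close> and \<open>p j k > 0\<close>, a strict inequality at
  \<open>j\<close> would make the finite integrals for \<open>k\<close> differ. Hence equality
  spreads backwards along transitions, and by irreducibility every state leads to
  \<open>i\<close>.\<close>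

lemma occupation_eq: "occupation i k = ennreal (m k / m i)"
proof -
  have one_step: "occupation i j = ennreal (m j / m i)" if k: "occupation i k = ennreal (m k / m i)" and pos: "0 < p j k" for j k
  proof (rule ccontr)
    assume neq: "occupation i j \<noteq> ennreal (m j / m i)"
    let ?a = "\<lambda>j. occupation i j * ennreal (p j k)" and ?b = "\<lambda>j. ennreal (m j / m i) * ennreal (p j k)"
    have "occupation i j < ennreal (m j / m i)" using neq occupation_le[of i j] by simp
    then have lt: "?a j < ?b j" using pos
      by (intro ennreal_mult_strict_right_mono) (auto simp: mult_strict_right_mono)
    have "(\<integral>\<^sup>+l. ?a l \<partial>count_space UNIV) < (\<integral>\<^sup>+l. ?b l \<partial>count_space UNIV)"
    proof (rule nn_integral_less)
      show "(\<integral>\<^sup>+l. ?a l \<partial>count_space UNIV) \<noteq> \<infinity>" unfolding occupation_stationary k by simp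
      show "\<not> (AE l in count_space UNIV. ?b l \<le> ?a l)"
        using lt by (auto simp: AE_count_space not_le)
    qed (auto intro!: mult_right_mono occupation_le)
    then show False unfolding occupation_stationary nn_integral_stationary[OF m_pos] k by simp
  qed
  have "occupation i j = ennreal (m j / m i)" if "0 < matrix_power p n j i" for n j
    using that
  proof (induction n arbitrary: j)
    case 0
    then have j: "j = i" by (cases "j = i") auto
    have "(taboo p i ^^ Suc t) (indicator {i}) i = 0" for t
      unfolding taboo_indicator_Suc by simp
    then have "occupation i i = 1"
      unfolding occupation_def by (subst suminf_offset[where i = 1]) (simp_all del: funpow.simps)
    then show ?case using j m_pos[of i] by simp
  next
    case (Suc n)
    have "\<exists>l. p j l * matrix_power p n l i \<noteq> 0"
    proof (rule ccontr)
      assume "\<nexists>l. p j l * matrix_power p n l i \<noteq> 0"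
      then have "matrix_power p (Suc n) j i = 0" by (simp add: infsum_0)
      then show False using Suc.prems by simp
    qed
    then obtain l where "p j l \<noteq> 0" "matrix_power p n l i \<noteq> 0" by auto
    then have "0 < p j l" "0 < matrix_power p n l i"
      using p_nonneg[of j l] matrix_power_nonneg[of n l i] by linarith+
    then show ?case using Suc.IH[of l] one_step[of l j] by simp
  qed
  then show ?thesis using irreducible unfolding irreducible_matrix_def by blast
qed

lemma suminf_taboo_pow:
  "(\<Sum>t. (taboo p i ^^ t) f i) = (\<integral>\<^sup>+k. f k * ennreal (m k / m i) \<partial>count_space UNIV)"
proof -
  have "(\<Sum>t. (taboo p i ^^ t) f i) = (\<Sum>t. \<integral>\<^sup>+k. f k * (taboo p i ^^ t) (indicator {k}) i \<partial>count_space UNIV)"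
    unfolding taboo_pow_eq_sum[of _ p i f] ..
  also have "\<dots> = (\<integral>\<^sup>+k. (\<Sum>t. f k * (taboo p i ^^ t) (indicator {k}) i) \<partial>count_space UNIV)"
    by (intro nn_integral_suminf[symmetric]) simp
  finally show ?thesis unfolding ennreal_suminf_cmult occupation_def[symmetric] occupation_eq .
qed

text \<open>Let \<open>\<rho> j\<close> be the probability of never reaching \<open>i\<close> at a
  positive time from \<open>j\<close>. An excursion from \<open>i\<close> that is at
  \<open>j\<close> at time \<open>t\<close> and avoids \<open>i\<close> afterwards never returns, so
  \<open>(taboo p i ^^ t) \<rho> i\<close> is zero for every \<open>t\<close>. The sum over
  \<open>t\<close> weights \<open>\<rho> j\<close> with \<open>m j / m i > 0\<close>, which forces
  \<rho> to vanish everywhere.\<close>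

lemma hitting_sure: "(\<lambda>n. (taboo p i ^^ n) (\<lambda>k. 1) j) \<longlonglongrightarrow> 0"
proof -
  let ?r = "\<lambda>n j. (taboo p i ^^ n) (\<lambda>k. 1) j"
  define \<rho> where "\<rho> j = (INF n. ?r n j)" for j
  have dec: "decseq (\<lambda>n. ?r n j)" for j
    unfolding taboo_pow_one[OF p] decseq_def
  proof (intro allI impI emeasure_mono)
    fix n n' :: nat assume "n \<le> n'"
    then show "{x. \<forall>k\<in>{1..n'}. x k \<noteq> i} \<subseteq> {x. \<forall>k\<in>{1..n}. x k \<noteq> i}" by auto
    show "{x. \<forall>k\<in>{1..n}. x k \<noteq> i} \<in> sets (chain_law p j)"
      using sets_avoiding_paths by simp
  qed
  have lim: "(\<lambda>n. ?r n j) \<longlonglongrightarrow> \<rho> j" for j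
    unfolding \<rho>_def by (rule LIMSEQ_INF[OF dec])
  have "\<rho> i = 0" using LIMSEQ_unique[OF lim taboo_pow_one_tendsto_0] .
  have pow: "(taboo p i ^^ t) \<rho> i \<le> ?r (t + n) i" for t n
  proof -
    have "(taboo p i ^^ t) \<rho> i \<le> (taboo p i ^^ t) (?r n) i"
      unfolding \<rho>_def by (intro taboo_pow_mono INF_lower) simp
    then show ?thesis by (simp add: funpow_add)
  qed
  have "(taboo p i ^^ t) \<rho> i = 0" for t
  proof -
    have "(\<lambda>n. ?r (t + n) i) \<longlonglongrightarrow> 0"
      using LIMSEQ_ignore_initial_segment[OF taboo_pow_one_tendsto_0[of i], of t] by (simp add: add.commute)
    from LIMSEQ_le_const[OF this, of "(taboo p i ^^ t) \<rho> i"] pow show ?thesis by simp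
  qed
  then have "(\<integral>\<^sup>+k. \<rho> k * ennreal (m k / m i) \<partial>count_space UNIV) = 0"
    using suminf_taboo_pow[of i \<rho>] by simp
  then have "\<rho> j * ennreal (m j / m i) = 0"
    by (subst (asm) nn_integral_0_iff_AE) (auto simp: AE_count_space)
  then have "\<rho> j = 0" using m_pos[of i] m_pos[of j] by simp
  then show ?thesis using lim[of j] by simp
qed

text \<open>Stop the chain on its first visit to \<open>i\<close> at a positive time: for harmonic
  \<open>V\<close>, Dynkin's formula expresses \<open>V j\<close> by the stopped value, and the part
  not yet stopped disappears because \<open>V\<close> is bounded and \<open>i\<close> is reached
  almost surely.\<close>

lemma bounded_harmonic_const:
  assumes V: "\<And>j. V j = (\<integral>\<^sup>+k. V k \<partial>row_pmf p j)" and V1: "\<And>j. V j \<le> 1"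
  shows "V j = V i"
proof -
  have fin: "(\<Sum>t<n. (taboo p i ^^ t) V j) \<noteq> top" for n
  proof -
    have "(taboo p i ^^ t) V j \<le> 1" for t
      using taboo_pow_mono[of V "\<lambda>_. 1" t p i j] V1 taboo_pow_one_le[of t i j] by (auto intro: order_trans)
    then have "(taboo p i ^^ t) V j < top" for t
      using ennreal_one_less_top le_less_trans by blast
    then show ?thesis by (simp add: less_top[symmetric])
  qed
  have eq: "V i * (taboo p i ^^ n) (\<lambda>k. 1) j + V j = (taboo p i ^^ n) V j + V i" for n
    using taboo_dynkin[where f = V and g = V and n = n and i = i and x = j, OF V] fin[of n] by (simp add: add.assoc)
  have 1: "(\<lambda>n. V i * (taboo p i ^^ n) (\<lambda>k. 1) j + V j) \<longlonglongrightarrow> V i * 0 + V j"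
    using V1[of i] by (intro tendsto_add ennreal_tendsto_cmult hitting_sure tendsto_const) (auto simp: less_top[symmetric] top_unique)
  have "(\<lambda>n. (taboo p i ^^ n) V j) \<longlonglongrightarrow> 0"
    by (rule tendsto_sandwich[OF _ _ tendsto_const hitting_sure[of i j]])
      (auto intro!: always_eventually taboo_pow_mono V1)
  then have "(\<lambda>n. (taboo p i ^^ n) V j + V i) \<longlonglongrightarrow> 0 + V i"
    by (intro tendsto_add tendsto_const)
  with 1 show ?thesis unfolding eq using LIMSEQ_unique by fastforce
qed

end

subsection \<open>Survival probability of the imbalance walk\<close>

lemma measurable_sum_int:
  fixes f :: "nat \<Rightarrow> 'a \<Rightarrow> int"
  assumes "\<And>l. l < n \<Longrightarrow> f l \<in> measurable M (count_space UNIV)"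
  shows "(\<lambda>x. \<Sum>l<n. f l x) \<in> measurable M (count_space UNIV)"
  using assms
proof (induction n)
  case (Suc n)
  have "(\<lambda>x. (\<lambda>a x. a + f n x) (\<Sum>l<n. f l x) x) \<in> measurable M (count_space UNIV)"
  proof (rule measurable_compose_countable[where f = "\<lambda>a x. a + f n x"])
    show "(\<lambda>x. a + f n x) \<in> measurable M (count_space UNIV)" for a
      using Suc.prems[of n] by (intro measurable_compose[where f = "f n" and g = "\<lambda>b. a + b"]) auto
    show "(\<lambda>x. \<Sum>l<n. f l x) \<in> measurable M (count_space UNIV)"
      using Suc by simp
  qed
  then show ?case by simp
qed simp

definition weight :: "'s \<Rightarrow> ('s \<Rightarrow> nat) \<Rightarrow> 's \<Rightarrow> int" where
  "weight i c k = of_bool (k = i) - int (c k)"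

text \<open>The level \<open>s\<close> already contains the weight of \<open>x 0\<close>, so the
  sums start with \<open>x 1\<close>; the case \<open>n = 0\<close> demands
  \<open>0 < s\<close>.\<close>

definition positive_forever :: "'s \<Rightarrow> ('s \<Rightarrow> nat) \<Rightarrow> int \<Rightarrow> (nat \<Rightarrow> 's) set" where
  "positive_forever i c s = {x. \<forall>n. 0 < s + (\<Sum>l<n. weight i c (x (Suc l)))}"

lemma sets_positive_forever: "positive_forever i c s \<in> sets (paths :: (nat \<Rightarrow> 's::countable) measure)"
proof -
  have "(\<lambda>x. \<Sum>l<n. weight i c (x (Suc l))) \<in> measurable paths (count_space UNIV)" for n
    by (rule measurable_sum_int)
      (rule measurable_compose[where g = "weight i c", OF measurable_coordinate_const], simp)
  from measurable_sets[OF this, of "{a. 0 < s + a}"]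
  have "{x :: nat \<Rightarrow> 's. 0 < s + (\<Sum>l<n. weight i c (x (Suc l)))} \<in> sets paths" for n
    by (simp add: vimage_def)
  then have "(\<Inter>n. {x :: nat \<Rightarrow> 's. 0 < s + (\<Sum>l<n. weight i c (x (Suc l)))}) \<in> sets paths"
    by (intro sets.countable_INT') auto
  also have "(\<Inter>n. {x :: nat \<Rightarrow> 's. 0 < s + (\<Sum>l<n. weight i c (x (Suc l)))}) = positive_forever i c s"
    by (auto simp: positive_forever_def)
  finally show ?thesis .
qed

lemma case_nat_positive_forever:
  "case_nat j y \<in> positive_forever i c s \<longleftrightarrow> 0 < s \<and> y \<in> positive_forever i c (s + weight i c (y 0))"
proof -
  have "(\<forall>n. 0 < s + (\<Sum>l<n. weight i c (y l))) \<longleftrightarrow>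
    0 < s \<and> (\<forall>n. 0 < s + (\<Sum>l<Suc n. weight i c (y l)))" (is "(\<forall>n. ?P n) \<longleftrightarrow> 0 < s \<and> (\<forall>n. ?P (Suc n))")
  proof (intro iffI allI conjI)
    show "0 < s" if "\<forall>n. ?P n" using spec[OF that, of 0] by simp
    show "?P (Suc n)" if "\<forall>n. ?P n" for n using that by blast
    show "?P n" if "0 < s \<and> (\<forall>n. ?P (Suc n))" for n
      using that by (cases n) (simp, blast)
  qed
  then show ?thesis
    unfolding positive_forever_def sum.lessThan_Suc_shift by (simp add: add.assoc)
qed

context recurrent_chain
begin

definition survival :: "'s \<Rightarrow> ('s \<Rightarrow> nat) \<Rightarrow> 's \<Rightarrow> int \<Rightarrow> ennreal" where
  "survival i c k s = emeasure (chain_law p k) (positive_forever i c s)"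

lemma survival_nonpos: "s \<le> 0 \<Longrightarrow> survival i c k s = 0"
proof -
  assume "s \<le> 0"
  then have "x \<notin> positive_forever i c s" for x
    unfolding positive_forever_def by (auto intro!: exI[of _ 0])
  then have "positive_forever i c s = {}" by blast
  then show ?thesis by (simp add: survival_def)
qed

lemma survival_mono: "s \<le> s' \<Longrightarrow> survival i c k s \<le> survival i c k s'"
  unfolding survival_def
proof (rule emeasure_mono)
  assume le: "s \<le> s'"
  show "positive_forever i c s \<subseteq> positive_forever i c s'"
    unfolding positive_forever_def
  proof (intro subsetI CollectI allI)
    fix x n assume "x \<in> {x. \<forall>n. 0 < s + (\<Sum>l<n. weight i c (x (Suc l)))}"
    then have "0 < s + (\<Sum>l<n. weight i c (x (Suc l)))" by blast
    then show "0 < s' + (\<Sum>l<n. weight i c (x (Suc l)))" using le by linarith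
  qed
qed (simp add: sets_positive_forever)

lemma survival_le_1: "survival i c k s \<le> 1"
  unfolding survival_def by (intro prob_space.emeasure_le_1 prob_space_chain_law)

lemma survival_first_step:
  assumes "0 < s"
  shows "survival i c j s = (\<integral>\<^sup>+k. survival i c k (s + weight i c k) \<partial>row_pmf p j)"
proof -
  have "survival i c j s = (\<integral>\<^sup>+k. emeasure (chain_law p k) {y. case_nat j y \<in> positive_forever i c s} \<partial>row_pmf p j)"
    unfolding survival_def by (rule emeasure_chain_law_first_step[OF p sets_positive_forever])
  also have "\<dots> = (\<integral>\<^sup>+k. survival i c k (s + weight i c k) \<partial>row_pmf p j)"
  proof (rule nn_integral_cong)
    fix k
    from measurable_sets[OF measurable_case_nat_path sets_positive_forever, of j i c s]
    have S: "{y. case_nat j y \<in> positive_forever i c s} \<in> sets paths" by (simp add: vimage_def)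
    show "emeasure (chain_law p k) {y. case_nat j y \<in> positive_forever i c s} = survival i c k (s + weight i c k)"
      unfolding survival_def
    proof (rule emeasure_eq_AE)
      show "AE x in chain_law p k. (x \<in> {y. case_nat j y \<in> positive_forever i c s}) =
          (x \<in> positive_forever i c (s + weight i c k))"
        using AE_chain_law_start[OF p, of k] by eventually_elim (simp add: case_nat_positive_forever assms)
    qed (use S sets_positive_forever in simp_all)
  qed
  finally show ?thesis .
qed

text \<open>By continuity from below this is the probability that the partial sums of the weights
  are bounded below.\<close>

definition survival_limit :: "'s \<Rightarrow> ('s \<Rightarrow> nat) \<Rightarrow> 's \<Rightarrow> ennreal" where
  "survival_limit i c k = (SUP L. survival i c k (int L))"

lemma SUP_survival: "(SUP L. survival i c k (int L + a)) = survival_limit i c k"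
proof (rule antisym)
  show "(SUP L. survival i c k (int L + a)) \<le> survival_limit i c k"
    unfolding survival_limit_def
  proof (rule SUP_mono)
    fix L :: nat
    show "\<exists>L'\<in>UNIV. survival i c k (int L + a) \<le> survival i c k (int L')"
      by (rule bexI[of _ "L + nat \<bar>a\<bar>"]) (auto intro: survival_mono)
  qed
  show "survival_limit i c k \<le> (SUP L. survival i c k (int L + a))"
    unfolding survival_limit_def
  proof (rule SUP_mono)
    fix L :: nat
    show "\<exists>L'\<in>UNIV. survival i c k (int L) \<le> survival i c k (int L' + a)"
      by (rule bexI[of _ "L + nat \<bar>a\<bar>"]) (auto intro: survival_mono)
  qed
qed

lemma survival_limit_le_1: "survival_limit i c k \<le> 1"
  unfolding survival_limit_def by (intro SUP_least survival_le_1)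

text \<open>A first step changes the level by an amount depending on the new state, but the supremum
  over all levels does not see a fixed shift. The limit is therefore harmonic, and it is bounded by
  1.\<close>

lemma survival_limit_const: "survival_limit i c k = survival_limit i c j"
proof (rule bounded_harmonic_const[OF _ survival_limit_le_1])
  fix j
  \<comment> \<open>The added 1 makes all levels positive, as \<open>survival_first_step\<close>
    requires.\<close>
  have "survival_limit i c j = (SUP L. survival i c j (int L + 1))" by (rule SUP_survival[symmetric])
  also have "\<dots> = (SUP L. \<integral>\<^sup>+k. survival i c k (int L + (1 + weight i c k)) \<partial>row_pmf p j)"
    by (simp add: survival_first_step add.assoc)
  also have "\<dots> = (\<integral>\<^sup>+k. (SUP L. survival i c k (int L + (1 + weight i c k))) \<partial>row_pmf p j)"
    by (intro nn_integral_monotone_convergence_SUP[symmetric])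
      (auto simp: incseq_def le_fun_def intro!: survival_mono)
  also have "\<dots> = (\<integral>\<^sup>+k. survival_limit i c k \<partial>row_pmf p j)" unfolding SUP_survival ..
  finally show "survival_limit i c j = (\<integral>\<^sup>+k. survival_limit i c k \<partial>row_pmf p j)" .
qed

text \<open>
  Summing the first-step equation over the levels \<open>1, \<dots>, L\<close> makes all but the boundary terms cancel;
  Dynkin's formula over an excursion from \<open>i\<close> leaves a balance between level \<open>1\<close> and the levels
  near \<open>L\<close>, which for \<open>L \<longlonglongrightarrow> \<infinity>\<close> can only hold if survival from level \<open>1\<close> has probability zero.
\<close>
lemma survival_balance:
  assumes "c i = 0"
  shows "(\<integral>\<^sup>+k. (if k = i then survival i c i 1 else of_nat (c k) * survival i c k (int L - int (c k) + 1)) *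
    ennreal (m k / m i) \<partial>count_space UNIV) \<le> survival_limit i c i"
proof -
  let ?R = "taboo p i" and ?v = "survival i c" and ?w = "weight i c"
  define A where "A j = (\<Sum>s\<in>{1..int L}. ?v j s)" for j
  define C where "C k = (\<Sum>s\<in>{1..int L}. ?v k (s + ?w k))" for k
  \<comment> \<open>\<open>A\<close> sums over the levels before a step and \<open>C\<close> over
    the levels reached. At \<open>i\<close> levels move up by one, so level 1 is lost and level
    \<open>L + 1\<close> is gained, with value \<open>u\<close>. At other \<open>k\<close> they move
    down by \<open>c k\<close>: the top \<open>c k\<close> levels are lost, and those gained are
    nonpositive, where survival is zero. \<open>d\<close> collects the losses.\<close>
  define d where "d k = (if k = i then ?v i 1 else (\<Sum>s\<in>{int L - int (c k) + 1..int L}. ?v k s))" for k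
  define u where "u = ?v i (int L + 1)"
  have A_le: "A j \<le> of_nat L" for j
  proof -
    have "A j \<le> (\<Sum>s\<in>{1..int L}. 1)" unfolding A_def by (intro sum_mono survival_le_1)
    then show ?thesis by simp
  qed
  have C_le: "C j \<le> of_nat L" for j
  proof -
    have "C j \<le> (\<Sum>s\<in>{1..int L}. 1)" unfolding C_def by (intro sum_mono survival_le_1)
    then show ?thesis by simp
  qed
  have AC: "A j = (\<integral>\<^sup>+k. C k \<partial>row_pmf p j)" for j
    unfolding A_def C_def by (subst nn_integral_sum) (auto intro!: sum.cong survival_first_step)
  have bal: "C k + d k = A k + u * indicator {i} k" for k
  proof (cases "k = i")
    case True
    have "(\<Sum>s\<in>{1..int L}. ?v i (s + 1)) = (\<Sum>s\<in>{2..int L + 1}. ?v i s)"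
      by (rule sum.reindex_bij_witness[of _ "\<lambda>s. s - 1" "\<lambda>s. s + 1"]) auto
    moreover have "{1..int L + 1} = insert 1 {2..int L + 1}" "{1..int L + 1} = insert (int L + 1) {1..int L}" by auto
    then have "?v i 1 + (\<Sum>s\<in>{2..int L + 1}. ?v i s) = ?v i (int L + 1) + (\<Sum>s\<in>{1..int L}. ?v i s)"
      by (metis (no_types, lifting) atLeastAtMost_iff finite_atLeastAtMost_int sum.insert
        add_le_same_cancel1 not_one_le_zero numeral_le_one_iff semiring_norm(69))
    ultimately show ?thesis using True assms by (simp add: C_def d_def A_def u_def weight_def add_ac)
  next
    case False
    have "(\<Sum>s\<in>{1..int L}. ?v k (s - int (c k))) = (\<Sum>s\<in>{1 - int (c k)..int L - int (c k)}. ?v k s)"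
      by (rule sum.reindex_bij_witness[of _ "\<lambda>s. s + int (c k)" "\<lambda>s. s - int (c k)"]) auto
    moreover have "(\<Sum>s\<in>{1 - int (c k)..int L}. ?v k s) =
        (\<Sum>s\<in>{1 - int (c k)..int L - int (c k)}. ?v k s) + (\<Sum>s\<in>{int L - int (c k) + 1..int L}. ?v k s)"
      by (subst sum.union_disjoint[symmetric]) (auto intro!: sum.cong)
    moreover have "(\<Sum>s\<in>{1 - int (c k)..int L}. ?v k s) = (\<Sum>s\<in>{1..int L}. ?v k s)"
      by (intro sum.mono_neutral_right) (auto intro: survival_nonpos)
    ultimately show ?thesis using False by (simp add: C_def d_def A_def weight_def)
  qed
  have step: "(\<Sum>t<n. (?R ^^ t) d i) \<le> survival_limit i c i + of_nat L * (?R ^^ n) (\<lambda>k. 1) i" for n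
  proof -
    let ?S = "\<lambda>f. \<Sum>t<n. (?R ^^ t) f i"
    have fin: "?S A \<noteq> top"
    proof -
      have "(?R ^^ t) A i \<le> of_nat L" for t
      proof -
        have "(?R ^^ t) A i \<le> (?R ^^ t) (\<lambda>_. of_nat L) i" by (rule taboo_pow_mono) (rule A_le)
        also have "\<dots> \<le> of_nat L * 1"
          unfolding taboo_pow_const[of t p i "of_nat L"] by (intro mult_left_mono taboo_pow_one_le) simp
        finally show ?thesis by simp
      qed
      then have "(?R ^^ t) A i < top" for t
        by (rule le_less_trans) (simp add: of_nat_less_top)
      then show ?thesis by (simp add: less_top[symmetric])
    qed
    \<comment> \<open>An excursion starts and ends in \<open>i\<close>, so the two boundary terms
      \<open>C i\<close> of Dynkin's formula cancel.\<close>
    have "?S A + C i * (?R ^^ n) (\<lambda>k. 1) i + C i = ?S C + (?R ^^ n) C i + C i"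
      by (rule taboo_dynkin[OF AC])
    moreover have "C i \<noteq> top" using C_le[of i] by (auto simp: top_unique)
    ultimately have 1: "?S A + C i * (?R ^^ n) (\<lambda>k. 1) i = ?S C + (?R ^^ n) C i"
      by (simp add: add_ac)
    have "(\<lambda>k. C k + d k) = (\<lambda>k. A k + u * indicator {i} k)" using bal by blast
    then have "?S (\<lambda>k. C k + d k) = ?S (\<lambda>k. A k + u * indicator {i} k)" by simp
    then have 2: "?S C + ?S d = ?S A + u * ?S (indicator {i})"
      unfolding taboo_pow_add taboo_pow_cmult by (simp add: sum.distrib sum_distrib_left)
    have "?S A + (?S d + C i * (?R ^^ n) (\<lambda>k. 1) i) = (?S A + C i * (?R ^^ n) (\<lambda>k. 1) i) + ?S d"
      by (simp add: add_ac)
    also have "\<dots> = (?S C + ?S d) + (?R ^^ n) C i" unfolding 1 by (simp add: add_ac)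
    also have "\<dots> = ?S A + (u * ?S (indicator {i}) + (?R ^^ n) C i)" unfolding 2 by (simp add: add_ac)
    finally have "?S d + C i * (?R ^^ n) (\<lambda>k. 1) i = u * ?S (indicator {i}) + (?R ^^ n) C i"
      using fin by simp
    then have "?S d \<le> u * ?S (indicator {i}) + (?R ^^ n) C i"
      by (metis le_iff_add)
    also have "\<dots> \<le> survival_limit i c i * 1 + of_nat L * (?R ^^ n) (\<lambda>k. 1) i"
    proof (intro add_mono mult_mono)
      show "u \<le> survival_limit i c i"
        unfolding u_def SUP_survival[of i c i 1, symmetric] by (rule SUP_upper) simp
      \<comment> \<open>The gain \<open>u\<close> occurs only at \<open>i\<close>, which an
        excursion visits once before its return.\<close>
      have "?S (indicator {i}) \<le> occupation i i"
        unfolding occupation_def by (intro sum_le_suminf) auto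
      then show "?S (indicator {i}) \<le> 1" using m_pos[of i] by (simp add: occupation_eq)
      have "(?R ^^ n) C i \<le> (?R ^^ n) (\<lambda>_. of_nat L) i" by (rule taboo_pow_mono) (rule C_le)
      then show "(?R ^^ n) C i \<le> of_nat L * (?R ^^ n) (\<lambda>k. 1) i"
        unfolding taboo_pow_const[of n p i "of_nat L"] .
    qed simp_all
    finally show ?thesis by simp
  qed
  have "(\<lambda>n. survival_limit i c i + of_nat L * (?R ^^ n) (\<lambda>k. 1) i) \<longlonglongrightarrow> survival_limit i c i + of_nat L * 0"
    by (intro tendsto_add tendsto_const ennreal_tendsto_cmult taboo_pow_one_tendsto_0) (simp add: of_nat_less_top)
  from LIMSEQ_le[OF summable_LIMSEQ[OF summableI] this] step
  have "(\<Sum>t. (?R ^^ t) d i) \<le> survival_limit i c i + of_nat L * 0" by blast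
  then have "(\<integral>\<^sup>+k. d k * ennreal (m k / m i) \<partial>count_space UNIV) \<le> survival_limit i c i"
    unfolding suminf_taboo_pow by simp
  moreover have "(\<integral>\<^sup>+k. (if k = i then ?v i 1 else of_nat (c k) * ?v k (int L - int (c k) + 1)) *
    ennreal (m k / m i) \<partial>count_space UNIV) \<le> (\<integral>\<^sup>+k. d k * ennreal (m k / m i) \<partial>count_space UNIV)"
  \<comment> \<open>Each block of lost levels is bounded below by \<open>c k\<close> times its
    lowest level, so that the limit in \<open>L\<close> involves just one survival probability per
    state.\<close>
  proof (intro nn_integral_mono mult_right_mono)
    fix k
    have "of_nat (c k) * ?v k (int L - int (c k) + 1) = (\<Sum>s\<in>{int L - int (c k) + 1..int L}. ?v k (int L - int (c k) + 1))"
      by simp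
    also have "\<dots> \<le> (\<Sum>s\<in>{int L - int (c k) + 1..int L}. ?v k s)"
      by (intro sum_mono survival_mono) auto
    finally show "(if k = i then ?v i 1 else of_nat (c k) * ?v k (int L - int (c k) + 1)) \<le> d k"
      by (simp add: d_def)
  qed simp
  ultimately show ?thesis by (rule order_trans[rotated])
qed

text \<open>Monotone convergence in \<open>survival_balance\<close> gives
  \<open>?v i 1 + ?V * 1 \<le> ?V\<close>. The factor 1 is the hypothesis \<open>bal\<close>, that
  is, mean zero over an excursion, and it appears because the limit is the same for all states.
  Finiteness of \<open>?V\<close> allows cancellation.\<close>

lemma survival_eq_0:
  assumes c: "c i = 0" and bal: "(\<integral>\<^sup>+k. of_nat (c k) * ennreal (m k / m i) \<partial>count_space UNIV) = 1"
  shows "survival i c i 1 = 0"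
proof -
  let ?v = "survival i c" and ?V = "survival_limit i c i"
  let ?e = "\<lambda>L k. (if k = i then ?v i 1 else of_nat (c k) * ?v k (int L + (1 - int (c k)))) * ennreal (m k / m i)"
  have "?v i 1 + ?V = (\<integral>\<^sup>+k. ?v i 1 * indicator {i} k + ?V * (of_nat (c k) * ennreal (m k / m i)) \<partial>count_space UNIV)"
    using bal by (subst nn_integral_add) (simp_all add: nn_integral_cmult)
  also have "\<dots> = (\<integral>\<^sup>+k. (SUP L. ?e L k) \<partial>count_space UNIV)"
  proof (rule nn_integral_cong)
    fix k
    show "?v i 1 * indicator {i} k + ?V * (of_nat (c k) * ennreal (m k / m i)) = (SUP L. ?e L k)"
    proof (cases "k = i")
      case True
      then show ?thesis using c m_pos[of i] by simp
    next
      case False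
      then have "(SUP L. ?e L k) = of_nat (c k) * survival_limit i c k * ennreal (m k / m i)"
        by (simp add: SUP_mult_left_ennreal[symmetric] SUP_mult_right_ennreal[symmetric] SUP_survival)
      then show ?thesis using False survival_limit_const[of i c k i] by (simp add: mult_ac)
    qed
  qed
  also have "\<dots> = (SUP L. \<integral>\<^sup>+k. ?e L k \<partial>count_space UNIV)"
    by (intro nn_integral_monotone_convergence_SUP)
      (auto simp: incseq_def le_fun_def intro!: mult_right_mono mult_left_mono survival_mono)
  also have "\<dots> \<le> ?V"
  proof (rule SUP_least)
    fix L
    have e: "int L + (1 - int (c k)) = int L - int (c k) + 1" for k by simp
    show "(\<integral>\<^sup>+k. ?e L k \<partial>count_space UNIV) \<le> ?V"
      unfolding e by (rule survival_balance) (rule c)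
  qed
  finally have "?v i 1 + ?V \<le> 0 + ?V" by simp
  moreover have "?V \<noteq> top" using survival_limit_le_1[of i c i] by (auto simp: top_unique)
  ultimately show ?thesis by simp
qed

lemma AE_weight_sum_nonpos:
  assumes "(\<integral>\<^sup>+k. of_nat (c k) * ennreal (m k / m i) \<partial>count_space UNIV) = 1"
  shows "AE x in chain_law p i. \<exists>n. (\<Sum>l\<le>n. weight i c (x l)) \<le> 0"
proof -
  have "survival i c i (weight i c i) = 0"
  proof (cases "c i = 0")
    case True
    then show ?thesis using survival_eq_0[OF True assms] by (simp add: weight_def)
  next
    \<comment> \<open>The walk is already nonpositive at time 0, so the balancing time is 0.\<close>
    case False
    then show ?thesis by (intro survival_nonpos) (simp add: weight_def)
  qed
  then have "AE x in chain_law p i. x \<notin> positive_forever i c (weight i c i)"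
    unfolding survival_def by (intro AE_not_in) (simp add: null_sets_def sets_positive_forever)
  then show ?thesis using AE_chain_law_start[OF p, of i]
  proof eventually_elim
    case (elim x)
    then obtain n where "\<not> 0 < weight i c (x 0) + (\<Sum>l<n. weight i c (x (Suc l)))"
      unfolding positive_forever_def by blast
    then have "(\<Sum>l<Suc n. weight i c (x l)) \<le> 0" unfolding sum.lessThan_Suc_shift by simp
    then show ?case unfolding lessThan_Suc_atMost by blast
  qed
qed

end

subsection \<open>The balancing time\<close>

text \<open>The test is \<open>\<le> 0\<close> and not equality, since a visit to \<open>j\<close>
  lowers the sum by \<open>c j\<close> at once and may carry it below zero.\<close>

definition first_balance :: "'s \<Rightarrow> ('s \<Rightarrow> nat) \<Rightarrow> (int \<Rightarrow> 's) \<Rightarrow> int option" where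
  "first_balance i c x =
    (if \<exists>n. (\<Sum>l\<le>n. weight i c (x (int l))) \<le> 0
     then Some (int (LEAST n. (\<Sum>l\<le>n. weight i c (x (int l))) \<le> 0)) else None)"

lemma first_balance_eq_Some:
  "first_balance i c x = Some (int n) \<longleftrightarrow>
    (\<Sum>l\<le>n. weight i c (x (int l))) \<le> 0 \<and> (\<forall>n'<n. 0 < (\<Sum>l\<le>n'. weight i c (x (int l))))"
  (is "_ \<longleftrightarrow> ?P n \<and> _")
proof
  assume "first_balance i c x = Some (int n)"
  then have ex: "\<exists>n. ?P n" and n: "n = (LEAST n. ?P n)"
    by (auto simp: first_balance_def split: if_splits)
  have "?P n" unfolding n using ex by (rule LeastI_ex)
  moreover have "\<not> ?P n'" if "n' < n" for n' using that unfolding n by (rule not_less_Least)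
  ultimately show "?P n \<and> (\<forall>n'<n. 0 < (\<Sum>l\<le>n'. weight i c (x (int l))))" by (meson not_le)
next
  assume a: "?P n \<and> (\<forall>n'<n. 0 < (\<Sum>l\<le>n'. weight i c (x (int l))))"
  have "(LEAST n. ?P n) = n"
  proof (rule Least_equality)
    show "?P n" using a by blast
    show "n \<le> n'" if "?P n'" for n'
      using a that by (meson not_le)
  qed
  then show "first_balance i c x = Some (int n)" using a by (auto simp: first_balance_def)
qed

lemma first_balance_nonneg: "first_balance i c x = Some k \<Longrightarrow> 0 \<le> k"
  by (auto simp: first_balance_def split: if_splits)

text \<open>Measurability is asked only of the coordinates 0 to \<open>n\<close>, for an arbitrary
  measure space. It thus serves for path space and for the sigma-algebra generated by the chain up
  to time \<open>n\<close>.\<close>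

lemma sets_first_balance:
  fixes Y :: "int \<Rightarrow> 'w \<Rightarrow> 's::countable"
  assumes "\<And>t. 0 \<le> t \<Longrightarrow> t \<le> int n \<Longrightarrow> Y t \<in> measurable N (count_space UNIV)"
  shows "{\<omega>\<in>space N. first_balance i c (\<lambda>t. Y t \<omega>) = Some (int n)} \<in> sets N"
proof -
  have "(\<lambda>\<omega>. \<Sum>l<Suc n'. weight i c (Y (int l) \<omega>)) \<in> measurable N (count_space UNIV)" if "n' \<le> n" for n'
  proof (rule measurable_sum_int)
    fix l assume "l < Suc n'"
    then have "Y (int l) \<in> measurable N (count_space UNIV)" using assms that by simp
    then show "(\<lambda>\<omega>. weight i c (Y (int l) \<omega>)) \<in> measurable N (count_space UNIV)"
      by (rule measurable_compose[where g = "weight i c"]) simp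
  qed
  then have S: "(\<lambda>\<omega>. \<Sum>l\<le>n'. weight i c (Y (int l) \<omega>)) \<in> measurable N (count_space UNIV)" if "n' \<le> n" for n'
    using that by (simp add: lessThan_Suc_atMost)
  define P where "P n' = {\<omega>\<in>space N. (\<Sum>l\<le>n'. weight i c (Y (int l) \<omega>)) \<le> 0}" for n'
  have P: "P n' \<in> sets N" if "n' \<le> n" for n'
    using measurable_sets[OF S[OF that], of "{..0}"] by (simp add: P_def vimage_def Int_def conj_commute)
  have "{\<omega>\<in>space N. first_balance i c (\<lambda>t. Y t \<omega>) = Some (int n)} = P n - (\<Union>n'<n. P n')"
    unfolding first_balance_eq_Some P_def by (auto simp: not_le)
  then show ?thesis using P by (auto intro!: sets.Diff sets.finite_UN)
qed

lemma measurable_first_balance: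
  "first_balance i c \<in> measurable (paths :: (int \<Rightarrow> 's::countable) measure) (count_space UNIV)"
proof (rule measurable_count_space_eq_countable[THEN iffD2, OF countableI_type], intro conjI ballI)
  have Some: "first_balance i c -` {Some (int n)} \<in> sets (paths :: (int \<Rightarrow> 's) measure)" for n
    using sets_first_balance[of n "\<lambda>t x. x t" paths i c] by (simp add: vimage_def)
  fix k :: "int option"
  show "first_balance i c -` {k} \<inter> space paths \<in> sets (paths :: (int \<Rightarrow> 's) measure)"
  proof (cases k)
    case None
    have "first_balance i c -` {k} = UNIV - (\<Union>n. first_balance i c -` {Some (int n)})"
    proof -
      have "first_balance i c x = None \<longleftrightarrow> (\<forall>n. first_balance i c x \<noteq> Some (int n))" for x
        by (auto simp: first_balance_def)
      then show ?thesis using None by auto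
    qed
    moreover have "(\<Union>n. first_balance i c -` {Some (int n)}) \<in> sets (paths :: (int \<Rightarrow> 's) measure)"
      using Some by (intro sets.countable_UN) auto
    ultimately show ?thesis using sets.compl_sets[of _ "paths :: (int \<Rightarrow> 's) measure"] by simp
  next
    case (Some t)
    show ?thesis
    proof (cases "0 \<le> t")
      case True
      then show ?thesis using \<open>\<And>n. first_balance i c -` {Some (int n)} \<in> sets paths\<close>[of "nat t"] Some by simp
    next
      case False
      then have "first_balance i c -` {k} = {}" using Some first_balance_nonneg by fastforce
      then show ?thesis by simp
    qed
  qed
qed simp

text \<open>
  Visits to \<open>i\<close> are matched like opening and closing brackets, a visit to \<open>j\<close> closing up to \<open>c j\<close> brackets.
  The number of brackets that are opened from time \<open>- k\<close> on and are still open just before time 0 is different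
  for the different \<open>k\<close> that are matched with time 0.
\<close>
lemma card_arrivals_first_balance:
  "finite (arrivals i (first_balance i c) x) \<and> card (arrivals i (first_balance i c) x) \<le> c (x 0)"
proof -
  let ?A = "arrivals i (first_balance i c) x" and ?w = "\<lambda>t. weight i c (x t)"
  define D where "D k = (\<Sum>t\<in>{-k..<0}. ?w t)" for k
  have shift: "(\<Sum>l\<le>n. weight i c (shift_path (- k) x (int l))) = (\<Sum>t\<in>{-k..int n - k}. ?w t)" for n k
    by (rule sum.reindex_bij_witness[of _ "\<lambda>t. nat (t + k)" "\<lambda>l. int l - k"]) (auto simp: shift_path_def)
  have A: "0 \<le> k \<and> x (- k) = i \<and> D k + ?w 0 \<le> 0 \<and> (\<forall>u. - k \<le> u \<longrightarrow> u < 0 \<longrightarrow> 0 < (\<Sum>t\<in>{-k..u}. ?w t))"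
    if "k \<in> ?A" for k
  proof -
    have k: "x (- k) = i" "first_balance i c (shift_path (- k) x) = Some k"
      using that by (simp_all add: arrivals_def)
    have "0 \<le> k" using first_balance_nonneg[OF k(2)] .
    then obtain n where n: "k = int n" using nonneg_int_cases by blast
    have 1: "(\<Sum>t\<in>{-k..0}. ?w t) \<le> 0" and 2: "\<And>n'. n' < n \<Longrightarrow> 0 < (\<Sum>t\<in>{-k..int n' - k}. ?w t)"
      using k(2) first_balance_eq_Some[of i c "shift_path (- k) x" n] unfolding shift n by auto
    have "{-k..0} = insert 0 {-k..<0}" using \<open>0 \<le> k\<close> by auto
    then have "D k + ?w 0 \<le> 0" using 1 by (simp add: D_def)
    moreover have "0 < (\<Sum>t\<in>{-k..u}. ?w t)" if "- k \<le> u" "u < 0" for u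
      using 2[of "nat (u + k)"] that n by simp
    ultimately show ?thesis using k(1) \<open>0 \<le> k\<close> by blast
  qed
  have D_less: "D k < D k'" if "k \<in> ?A" "k' \<in> ?A" "k < k'" for k k'
  proof -
    have "{-k'..<0} = {-k'..- k - 1} \<union> {-k..<0}" using that(3) A[OF that(1)] by auto
    then have "D k' = (\<Sum>t\<in>{-k'..- k - 1} \<union> {-k..<0}. ?w t)"
      by (simp only: D_def)
    also have "\<dots> = (\<Sum>t\<in>{-k'..- k - 1}. ?w t) + D k"
      unfolding D_def by (rule sum.union_disjoint) auto
    finally have "D k' = (\<Sum>t\<in>{-k'..- k - 1}. ?w t) + D k" .
    \<comment> \<open>The unit sent at time \<open>- k'\<close> is still unmatched at time
      \<open>- k - 1\<close>, so its partial sum up to there is positive.\<close>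
    moreover have "0 < (\<Sum>t\<in>{-k'..- k - 1}. ?w t)" using A[OF that(1)] A[OF that(2)] that(3) by simp
    ultimately show ?thesis by simp
  qed
  have inj: "inj_on D ?A"
  proof (rule inj_onI)
    fix k k' assume "k \<in> ?A" "k' \<in> ?A" "D k = D k'"
    then show "k = k'" using D_less[of k k'] D_less[of k' k] by (cases k k' rule: linorder_cases) auto
  qed
  \<comment> \<open>The possible values of \<open>D k\<close>. If \<open>x 0\<close> is not
    \<open>i\<close>, then \<open>0 < D k\<close> and \<open>D k \<le> c (x 0)\<close>. If
    \<open>x 0 = i\<close>, the visit at time 0 opens a bracket itself, which admits
    \<open>k = 0\<close> with \<open>D 0 = 0\<close> but lowers the upper bound by one. Either way
    there are \<open>c (x 0)\<close> values.\<close>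
  let ?B = "{of_bool (x 0 \<noteq> i)..int (c (x 0)) - of_bool (x 0 = i)}"
  have "D ` ?A \<subseteq> ?B"
  proof
    fix d assume "d \<in> D ` ?A"
    then obtain k where k: "k \<in> ?A" "d = D k" by blast
    have "0 < D k" if "0 < k"
    proof -
      have "{-k..<0} = {-k..-1}" by auto
      then show ?thesis using A[OF k(1)] that by (simp add: D_def)
    qed
    moreover have "0 \<le> D k" if "k = 0" using that by (simp add: D_def)
    moreover have "x 0 = i" if "k = 0" using A[OF k(1)] that by simp
    moreover have "0 \<le> k" "D k \<le> - ?w 0" using A[OF k(1)] by simp_all
    ultimately show "d \<in> ?B" unfolding k(2) by (cases "k = 0"; cases "x 0 = i") (auto simp: weight_def)
  qed
  moreover have "finite ?B" by simp
  moreover have "card ?B = c (x 0)" by (cases "x 0 = i") auto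
  ultimately show ?thesis using inj card_inj_on_le[OF inj, of ?B] finite_subset finite_imageD by metis
qed

section \<open>Sufficiency: the law of the path seen from the balancing time\<close>

lemma measurable_shifted_process:
  fixes X :: "int \<Rightarrow> 'w \<Rightarrow> 's::countable"
  assumes X: "\<And>n. X n \<in> measurable M (count_space UNIV)" and T: "T \<in> measurable M (count_space UNIV)"
  shows "shifted_process X T n \<in> measurable M (count_space UNIV)"
proof -
  have "(\<lambda>\<omega>. (\<lambda>k \<omega>. X (n + the k) \<omega>) (T \<omega>) \<omega>) \<in> measurable M (count_space UNIV)"
    by (rule measurable_compose_countable[where f = "\<lambda>k \<omega>. X (n + the k) \<omega>", OF X T])
  then show ?thesis by (simp add: shifted_process_def[abs_def])
qed

lemma (in recurrent_chain) first_balance_shift: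
  fixes M :: "'w measure" and X :: "int \<Rightarrow> 'w \<Rightarrow> 's" and \<nu> :: "'s pmf"
  assumes X: "two_sided_markov_chain M X p m (return_pmf i)"
    and c: "\<And>j. m i / m j * pmf \<nu> j = real (c j)"
  defines "T \<equiv> \<lambda>\<omega>. first_balance i c (\<lambda>n. X n \<omega>)"
  shows "nonrandomized_time M X T" and "two_sided_stopping_time M X T"
    and "two_sided_markov_chain M (shifted_process X T) p m \<nu>"
proof -
  interpret M: prob_space M using X by (simp add: two_sided_markov_chain_def)
  have meas: "\<And>n. X n \<in> measurable M (count_space UNIV)" using X by (simp add: two_sided_markov_chain_def)
  have T: "T \<in> measurable M (count_space UNIV)"
    unfolding T_def by (rule measurable_compose[OF measurable_paths[of X M, OF meas] measurable_first_balance])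
  have c': "of_nat (c j) * ennreal (m j / m i) = ennreal (pmf \<nu> j)" for j
  proof -
    have "real (c j) * (m j / m i) = pmf \<nu> j" unfolding c[symmetric] using m_pos[of i] m_pos[of j] by simp
    then show ?thesis using less_imp_le[OF m_pos] by (simp add: ennreal_of_nat_eq_real_of_nat ennreal_mult[symmetric])
  qed
  have nu: "(\<integral>\<^sup>+j. ennreal (pmf \<nu> j) \<partial>count_space UNIV) = 1"
    by (simp add: nn_integral_pmf measure_pmf.emeasure_space_1[simplified])
  have fin: "AE \<omega> in M. T \<omega> \<noteq> None"
  proof -
    \<comment> \<open>The chain property is given conditionally on \<open>X 0 = i\<close>. This
      event has probability 1, so almost sure statements pass back to \<open>M\<close>.\<close>
    define A where "A = {\<omega>\<in>space M. X 0 \<omega> = i}"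
    define Mi where "Mi = uniform_measure M A"
    have A: "A \<in> sets M" unfolding A_def using measurable_sets[OF meas[of 0], of "{i}"]
      by (simp add: vimage_def Int_def conj_commute)
    have AE_A: "AE \<omega> in M. \<omega> \<in> A" using two_sided_start_AE[OF X] AE_space by eventually_elim (simp add: A_def)
    then have "emeasure M A = 1" using A M.emeasure_eq_1_AE by simp
    have mc: "markov_chain Mi (\<lambda>n. X (int n)) p"
      using X unfolding two_sided_markov_chain_def Let_def Mi_def A_def set_return_pmf by blast
    have sMi: "sets Mi = sets M" by (simp add: Mi_def)
    have AE_Mi: "(AE \<omega> in Mi. P \<omega>) \<longleftrightarrow> (AE \<omega> in M. \<omega> \<in> A \<longrightarrow> P \<omega>)" for P
      unfolding Mi_def using \<open>emeasure M A = 1\<close> A by (intro AE_uniform_measure) auto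
    have eq: "distr Mi paths (\<lambda>\<omega> n. X (int n) \<omega>) = chain_law p i"
      by (rule markov_chain_distr[OF mc p]) (unfold AE_Mi, simp add: A_def)
    have "AE x in distr Mi paths (\<lambda>\<omega> n. X (int n) \<omega>). \<exists>n. (\<Sum>l\<le>n. weight i c (x l)) \<le> 0"
      unfolding eq by (rule AE_weight_sum_nonpos) (unfold c', rule nu)
    moreover have "(\<lambda>\<omega> n. X (int n) \<omega>) \<in> measurable Mi paths"
      using meas unfolding measurable_cong_sets[OF sMi refl] by (intro measurable_paths)
    moreover have "{x :: nat \<Rightarrow> 's. \<exists>n. (\<Sum>l\<le>n. weight i c (x l)) \<le> 0} \<in> sets paths"
    proof -
      have "(\<lambda>x :: nat \<Rightarrow> 's. \<Sum>l<Suc n. weight i c (x l)) \<in> measurable paths (count_space UNIV)" for n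
        by (rule measurable_sum_int)
          (rule measurable_compose[where g = "weight i c", OF measurable_coordinate_const], simp)
      from measurable_sets[OF this, of "{..0}"]
      have "{x :: nat \<Rightarrow> 's. (\<Sum>l\<le>n. weight i c (x l)) \<le> 0} \<in> sets paths" for n
        by (simp add: vimage_def lessThan_Suc_atMost)
      then have "(\<Union>n. {x :: nat \<Rightarrow> 's. (\<Sum>l\<le>n. weight i c (x l)) \<le> 0}) \<in> sets paths"
        by (intro sets.countable_UN) auto
      also have "(\<Union>n. {x :: nat \<Rightarrow> 's. (\<Sum>l\<le>n. weight i c (x l)) \<le> 0}) = {x. \<exists>n. (\<Sum>l\<le>n. weight i c (x l)) \<le> 0}"
        by auto
      finally show ?thesis .
    qed
    ultimately have "AE \<omega> in Mi. \<exists>n. (\<Sum>l\<le>n. weight i c (X (int l) \<omega>)) \<le> 0"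
      by (subst (asm) AE_distr_iff) simp_all
    then have "AE \<omega> in M. \<omega> \<in> A \<longrightarrow> (\<exists>n. (\<Sum>l\<le>n. weight i c (X (int l) \<omega>)) \<le> 0)"
      unfolding AE_Mi .
    with AE_A show ?thesis by eventually_elim (simp add: T_def first_balance_def)
  qed
  have rt: "random_time M T" using T fin by (simp add: random_time_def)
  show "nonrandomized_time M X T"
    unfolding nonrandomized_time_def
    by (intro conjI rt bexI[of _ "first_balance i c"] measurable_first_balance) (simp add: T_def)
  show "two_sided_stopping_time M X T"
    unfolding two_sided_stopping_time_def
  proof (intro conjI rt ballI allI impI)
    show "0 \<le> t" if "T \<omega> = Some t" for \<omega> t using that unfolding T_def by (rule first_balance_nonneg)
    fix n :: nat
    let ?G = "{X k -` A \<inter> space M |k A. k \<le> int n}"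
    \<comment> \<open>The information up to time \<open>n\<close>, turned into a measure space so
      that \<open>sets_first_balance\<close> applies to it.\<close>
    define N where "N = sigma (space M) ?G"
    have G: "?G \<subseteq> Pow (space M)" by auto
    have sN: "space N = space M" and setsN: "sets N = sigma_sets (space M) ?G"
      unfolding N_def using G by (simp_all add: space_measure_of sets_measure_of)
    have "X t \<in> measurable N (count_space UNIV)" if "t \<le> int n" for t
      using that unfolding measurable_def sN setsN by (auto intro!: sigma_sets.Basic)
    then have "{\<omega>\<in>space N. first_balance i c (\<lambda>t. X t \<omega>) = Some (int n)} \<in> sets N"
      by (intro sets_first_balance)
    then show "{\<omega> \<in> space M. T \<omega> = Some (int n)} \<in> sigma_sets (space M) ?G"
      unfolding sN setsN T_def .
  qed
  have Y: "shifted_process X T n \<in> measurable M (count_space UNIV)" for n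
    by (rule measurable_shifted_process[OF meas T])
  define \<rho> where "\<rho> j B = emeasure M {\<omega>\<in>space M. shifted_process X T 0 \<omega> = j \<and> (\<lambda>n. shifted_process X T n \<omega>) \<in> B}" for j B
  have \<rho>_sets: "{\<omega>\<in>space M. shifted_process X T 0 \<omega> = j \<and> (\<lambda>n. shifted_process X T n \<omega>) \<in> B} \<in> sets M"
    if "B \<in> sets paths" for j B
  proof -
    have a: "(\<lambda>\<omega> n. shifted_process X T n \<omega>) -` B \<inter> space M \<in> sets M"
      using measurable_sets[OF measurable_paths[of "shifted_process X T" M, OF Y] that] .
    have b: "shifted_process X T 0 -` {j} \<inter> space M \<in> sets M"
      by (rule measurable_sets[OF Y]) simp
    from sets.Int[OF a b] show ?thesis by (simp add: vimage_def Int_def conj_ac)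
  qed
  \<comment> \<open>Mass transport with at most \<open>c j\<close> arrivals at a path with
    \<open>x 0 = j\<close>; \<open>c'\<close> converts this capacity into
    \<open>pmf \<nu> j\<close>. Almost sure finiteness of \<open>T\<close> enters here, through
    \<open>shifted_process_law\<close>.\<close>
  have \<rho>_le: "\<rho> j B \<le> ennreal (pmf \<nu> j) * emeasure (two_sided_law p m j) B" if B: "B \<in> sets paths" for j B
  proof -
    have "ennreal (m i) * \<rho> j B = ennreal (m j) *
      (\<integral>\<^sup>+x. emeasure (count_space UNIV) (arrivals i (first_balance i c) x) * indicator B x \<partial>two_sided_law p m j)"
    proof -
      have "\<rho> j B = emeasure (two_sided_law p m i) {x. \<exists>k. first_balance i c x = Some k \<and> x k = j \<and> shift_path k x \<in> B}"
        unfolding \<rho>_def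
        by (rule shifted_process_law[OF p m X measurable_first_balance _ fin B Y]) (simp add: T_def)
      then show ?thesis by (simp only: mass_transport[OF p m measurable_first_balance B])
    qed
    also have "\<dots> \<le> ennreal (m j) * (\<integral>\<^sup>+x. of_nat (c j) * indicator B x \<partial>two_sided_law p m j)"
    proof (intro mult_left_mono nn_integral_mono_AE)
      have "AE x in two_sided_law p m j. x 0 = j"
      proof -
        interpret J: prob_space "two_sided_law p m j" by (rule prob_space_two_sided_law)
        have "emeasure (two_sided_law p m j) {x. \<forall>t\<in>{- int 0..int 0}. x t = j} = 1"
          unfolding emeasure_two_sided_law_split[OF p m] by simp
        then have "AE x in two_sided_law p m j. x \<in> {x. x 0 = j}"
          by (intro J.AE_prob_1) (simp add: J.emeasure_eq_measure)
        then show ?thesis by simp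
      qed
      then show "AE x in two_sided_law p m j. emeasure (count_space UNIV) (arrivals i (first_balance i c) x) * indicator B x
          \<le> of_nat (c j) * indicator B x"
      proof eventually_elim
        case (elim x)
        then have "emeasure (count_space UNIV) (arrivals i (first_balance i c) x) \<le> of_nat (c j)"
          using card_arrivals_first_balance[of i c x] by (simp add: emeasure_count_space)
        then show ?case by (rule mult_right_mono) simp
      qed
    qed simp
    also have "\<dots> = ennreal (m j) * (of_nat (c j) * emeasure (two_sided_law p m j) B)"
      using B by (simp add: nn_integral_cmult_indicator)
    also have "\<dots> = ennreal (m i) * (ennreal (pmf \<nu> j) * emeasure (two_sided_law p m j) B)"
    proof -
      have "m i * (m j / m i) = m j" using m_pos[of i] by simp
      then have "ennreal (m i) * ennreal (m j / m i) = ennreal (m j)"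
        using less_imp_le[OF m_pos] by (simp add: ennreal_mult[symmetric])
      then show ?thesis unfolding c'[symmetric] by (metis mult.assoc mult.commute)
    qed
    finally show ?thesis using m_pos[of i] by (subst (asm) ennreal_mult_le_mult_iff) auto
  qed
  have law1: "emeasure (two_sided_law p m j) UNIV = 1" for j
    using prob_space.emeasure_space_1[OF prob_space_two_sided_law, of p m j] by simp
  have UNIV: "UNIV \<in> sets (paths :: (int \<Rightarrow> 's) measure)" using sets.top[of "paths :: (int \<Rightarrow> 's) measure"] by simp
  have \<rho>_total: "(\<integral>\<^sup>+j. \<rho> j UNIV \<partial>count_space UNIV) = 1"
  proof -
    have "(\<integral>\<^sup>+j. \<rho> j UNIV \<partial>count_space UNIV) = emeasure M (\<Union>j. {\<omega>\<in>space M. shifted_process X T 0 \<omega> = j \<and> (\<lambda>n. shifted_process X T n \<omega>) \<in> UNIV})"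
      unfolding \<rho>_def using \<rho>_sets[OF UNIV]
      by (intro emeasure_UN_countable[symmetric]) (auto simp: disjoint_family_on_def)
    also have "(\<Union>j. {\<omega>\<in>space M. shifted_process X T 0 \<omega> = j \<and> (\<lambda>n. shifted_process X T n \<omega>) \<in> UNIV}) = space M" by auto
    finally show ?thesis by (simp add: M.emeasure_space_1)
  qed
  \<comment> \<open>Both families of weights sum to 1 and one dominates the other, so no state can
    have a strict inequality.\<close>
  have \<rho>_UNIV: "\<rho> j UNIV = ennreal (pmf \<nu> j)" for j
  proof (rule ccontr)
    assume "\<rho> j UNIV \<noteq> ennreal (pmf \<nu> j)"
    moreover have le: "\<rho> j UNIV \<le> ennreal (pmf \<nu> j)" for j using \<rho>_le[OF UNIV, of j] law1[of j] by simp
    ultimately have lt: "\<rho> j UNIV < ennreal (pmf \<nu> j)" unfolding less_le by blast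
    have "(\<integral>\<^sup>+j. \<rho> j UNIV \<partial>count_space UNIV) < (\<integral>\<^sup>+j. ennreal (pmf \<nu> j) \<partial>count_space UNIV)"
    proof (rule nn_integral_less)
      show "\<not> (AE l in count_space UNIV. ennreal (pmf \<nu> l) \<le> \<rho> l UNIV)"
        using lt by (auto simp: AE_count_space not_le)
    qed (use le \<rho>_total in auto)
    then show False unfolding \<rho>_total nu by simp
  qed
  have \<rho>_eq: "\<rho> j B = ennreal (pmf \<nu> j) * emeasure (two_sided_law p m j) B" if B: "B \<in> sets paths" for j B
  proof (rule antisym[OF \<rho>_le[OF B]])
    let ?J = "two_sided_law p m j" and ?c = "ennreal (pmf \<nu> j)"
    \<comment> \<open>Domination holds on \<open>B\<close> and on \<open>- B\<close> while the
      totals agree, so it is an equality on both.\<close>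
    have B': "- B \<in> sets paths" using sets.compl_sets[OF B] by (simp add: Compl_eq_Diff_UNIV)
    have "?c * emeasure ?J B + \<rho> j (- B) \<le> ?c * emeasure ?J B + ?c * emeasure ?J (- B)"
      by (intro add_left_mono \<rho>_le B')
    also have "\<dots> = ?c * emeasure ?J (B \<union> - B)"
      unfolding distrib_left[symmetric] using B B' by (subst plus_emeasure) auto
    also have "\<dots> = \<rho> j (B \<union> - B)" using law1[of j] \<rho>_UNIV[of j] by simp
    also have "\<dots> = \<rho> j B + \<rho> j (- B)"
      unfolding \<rho>_def by (subst plus_emeasure[OF \<rho>_sets[OF B] \<rho>_sets[OF B']]) (auto intro!: arg_cong[where f = "emeasure M"])
    finally have "?c * emeasure ?J B + \<rho> j (- B) \<le> \<rho> j B + \<rho> j (- B)" .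
    moreover have "\<rho> j (- B) \<noteq> top" unfolding \<rho>_def by (rule M.emeasure_finite[unfolded infinity_ennreal_def])
    ultimately show "?c * emeasure ?J B \<le> \<rho> j B" by simp
  qed
  show "two_sided_markov_chain M (shifted_process X T) p m \<nu>"
    by (rule two_sided_markov_chainI[OF p m M.prob_space_axioms Y]) (use \<rho>_eq in \<open>simp add: \<rho>_def\<close>)
qed

theorem theorem1:
  fixes p :: "'s::countable \<Rightarrow> 's \<Rightarrow> real" and m :: "'s \<Rightarrow> real"
    and M :: "'w measure" and X :: "int \<Rightarrow> 'w \<Rightarrow> 's" and i :: 's and \<nu> :: "'s pmf"
  assumes "transition_matrix p"
    and "irreducible_matrix p"
    and "recurrent_matrix p"
    and "stationary_measure p m"
    and "two_sided_markov_chain M X p m (return_pmf i)"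
  shows "((\<exists>T. nonrandomized_time M X T \<and>
              two_sided_markov_chain M (shifted_process X T) p m \<nu>)
          \<longleftrightarrow> (\<forall>j. m i / m j * pmf \<nu> j \<in> \<int>))
       \<and> ((\<exists>T. nonrandomized_time M X T \<and>
              two_sided_markov_chain M (shifted_process X T) p m \<nu>)
          \<longrightarrow> (\<exists>T. nonrandomized_time M X T \<and> two_sided_stopping_time M X T \<and>
              two_sided_markov_chain M (shifted_process X T) p m \<nu>))"
proof -
  interpret recurrent_chain p m by standard (fact assms)+
  have necessary: "\<forall>j. m i / m j * pmf \<nu> j \<in> \<int>"
    if "\<exists>T. nonrandomized_time M X T \<and> two_sided_markov_chain M (shifted_process X T) p m \<nu>"
    using that shift_mass_integer[OF assms(1,4,5)] by blast
  have sufficient: "\<exists>T. nonrandomized_time M X T \<and> two_sided_stopping_time M X T \<and>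
      two_sided_markov_chain M (shifted_process X T) p m \<nu>" if "\<forall>j. m i / m j * pmf \<nu> j \<in> \<int>"
  proof -
    have "m i / m j * pmf \<nu> j = real (nat \<lfloor>m i / m j * pmf \<nu> j\<rfloor>)" for j
    proof -
      have "0 \<le> m i / m j * pmf \<nu> j" using less_imp_le[OF m_pos] by simp
      then show ?thesis using that by simp
    qed
    from first_balance_shift[OF assms(5) this] show ?thesis by blast
  qed
  show ?thesis using necessary sufficient by blast
qed

end
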